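(* Let $\mu,\nu\in\mathcal{P}_2(\mathbb{R}^n)$ be two Borel probability measures with common barycentre. Then the following conditions are equivalent: (i) $\mu\prec_{c-c}\nu$ with respect to some mutually complementing, orthogonal subspaces $V_1,V_2$ of $\mathbb{R}^n$; (ii) there exist mutually complementing, orthogonal subspaces $V_1,V_2$ such that for any $f\in\mathcal{C}^{1,1}(\mathbb{R}^n)$ that is convex-concave with respect to $V_1,V_2$, $$\int_{\mathbb{R}^n}f\,d\mu\le\int_{\mathbb{R}^n}f\,d\nu;$$ (iii) the supremum in the definition of $\mathcal{I}(\mu,\nu)$ is attained by some $u\in\mathcal{C}^{1,1}(\mathbb{R}^n)$ whose derivative $Du\colon\mathbb{R}^n\to\mathbb{R}^n$ is an isometry; (iv) there exist mutually complementing, orthogonal subspaces $V_1,V_2$ such that the supremum in $\mathcal{I}(\mu,\nu)$ is attained by the function $u_{V_1,V_2}\colon\mathbb{R}^n\to\mathbb{R}$ given by $$u_{V_1,V_2}(v)=\tfrac12\|P_{V_1}v\|^2-\tfrac12\|P_{V_2}v\|^2\quad\text{for all }v\in\mathbb{R}^n.$$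
   Context: $\|\cdot\|$ is the Euclidean norm and $P_W$ the orthogonal projection onto $W$. $\mathcal{P}_2(\mathbb{R}^n)$ is the set of Borel probability measures with finite second moment; the barycentre of $\mu$ is $\int x\,d\mu(x)$. $\mathcal{C}^{1,1}(\mathbb{R}^n)$ is the set of differentiable real functions on $\mathbb{R}^n$ with Lipschitz derivative; $Du$ is identified with the gradient map $\mathbb{R}^n\to\mathbb{R}^n$. Subspaces $V_1,V_2$ are mutually complementing if $V_1\oplus V_2=\mathbb{R}^n$. $$\mathcal{I}(\mu,\nu)=\sup\Big\{\int_{\mathbb{R}^n}v\,d(\nu-\mu)\mid v\in\mathcal{C}^{1,1}(\mathbb{R}^n)\text{ has }1\text{-Lipschitz derivative}\Big\};$$ the supremum is "attained by $u$" if $u$ is admissible and realises it. A function $f\colon\mathbb{R}^n\to\mathbb{R}$ is convex-concave with respect to $V_1,V_2$ if $v_1\mapsto f(v_1+v_2)$ is convex on $V_1$ for each $v_2\in V_2$ and $v_2\mapsto f(v_1+v_2)$ is concave on $V_2$ for each $v_1\in V_1$; it has at most quadratic growth if $|f(v)|\le C(1+\|v\|^2)$ for some $C\ge 0$ and all $v$. $\mu\prec_{c-c}\nu$ with respect to $V_1,V_2$ means $\int f\,d\mu\le\int f\,d\nu$ for all $f$ convex-concave with respect to $V_1,V_2$ and of at most quadratic growth. *)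

theory Defs
  imports "HOL-Analysis.Analysis" "HOL-Probability.Probability_Measure"
begin

definition P2 :: "(real ^ 'n) measure set" where
  "P2 = {\<mu>. prob_space \<mu> \<and> sets \<mu> = sets borel \<and> integrable \<mu> (\<lambda>x. (norm x)\<^sup>2)}"

definition barycentre :: "(real ^ 'n) measure \<Rightarrow> real ^ 'n" where
  "barycentre \<mu> = (\<integral>x. x \<partial>\<mu>)"

(* The derivative Du under the Riesz identification; only meaningful where u is differentiable. *)
definition gradient :: "(real ^ 'n \<Rightarrow> real) \<Rightarrow> real ^ 'n \<Rightarrow> real ^ 'n" where
  "gradient u x = (THE D. GDERIV u x :> D)"

definition C11 :: "(real ^ 'n \<Rightarrow> real) set" where
  "C11 = {u. (\<forall>x. u differentiable (at x)) \<and> (\<exists>L. L-lipschitz_on UNIV (gradient u))}"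

definition admissible :: "(real ^ 'n \<Rightarrow> real) set" where
  "admissible = {v \<in> C11. 1-lipschitz_on UNIV (gradient v)}"

definition integral_diff ::
  "(real ^ 'n) measure \<Rightarrow> (real ^ 'n) measure \<Rightarrow> (real ^ 'n \<Rightarrow> real) \<Rightarrow> real" where
  "integral_diff \<mu> \<nu> v = (\<integral>x. v x \<partial>\<nu>) - (\<integral>x. v x \<partial>\<mu>)"

(* Extended-real valued, so that the supremum is meaningful without a boundedness argument. *)
definition I_sup :: "(real ^ 'n) measure \<Rightarrow> (real ^ 'n) measure \<Rightarrow> ereal" where
  "I_sup \<mu> \<nu> = (SUP v\<in>admissible. ereal (integral_diff \<mu> \<nu> v))"

definition attains_I ::
  "(real ^ 'n) measure \<Rightarrow> (real ^ 'n) measure \<Rightarrow> (real ^ 'n \<Rightarrow> real) \<Rightarrow> bool" where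
  "attains_I \<mu> \<nu> u \<longleftrightarrow> u \<in> admissible \<and> ereal (integral_diff \<mu> \<nu> u) = I_sup \<mu> \<nu>"

definition isometry :: "('a::metric_space \<Rightarrow> 'b::metric_space) \<Rightarrow> bool" where
  "isometry T \<longleftrightarrow> (\<forall>x y. dist (T x) (T y) = dist x y)"

definition mutually_complementing :: "(real ^ 'n) set \<Rightarrow> (real ^ 'n) set \<Rightarrow> bool" where
  "mutually_complementing V1 V2 \<longleftrightarrow>
     subspace V1 \<and> subspace V2 \<and> V1 \<inter> V2 = {0} \<and> {v1 + v2 |v1 v2. v1 \<in> V1 \<and> v2 \<in> V2} = UNIV"

definition orthogonal_sets :: "(real ^ 'n) set \<Rightarrow> (real ^ 'n) set \<Rightarrow> bool" where
  "orthogonal_sets V1 V2 \<longleftrightarrow> (\<forall>v1\<in>V1. \<forall>v2\<in>V2. orthogonal v1 v2)"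

definition orth_proj :: "(real ^ 'n) set \<Rightarrow> real ^ 'n \<Rightarrow> real ^ 'n" where
  "orth_proj W v = (THE p. p \<in> W \<and> (\<forall>w\<in>W. orthogonal (v - p) w))"

definition convex_concave ::
  "(real ^ 'n) set \<Rightarrow> (real ^ 'n) set \<Rightarrow> (real ^ 'n \<Rightarrow> real) \<Rightarrow> bool" where
  "convex_concave V1 V2 f \<longleftrightarrow>
     (\<forall>v2\<in>V2. convex_on V1 (\<lambda>v1. f (v1 + v2))) \<and>
     (\<forall>v1\<in>V1. concave_on V2 (\<lambda>v2. f (v1 + v2)))"

definition quadratic_growth :: "(real ^ 'n \<Rightarrow> real) \<Rightarrow> bool" where
  "quadratic_growth f \<longleftrightarrow> (\<exists>C\<ge>0. \<forall>v. \<bar>f v\<bar> \<le> C * (1 + (norm v)\<^sup>2))"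

(* Every finite convex-concave f on complementing subspaces is continuous, so under quadratic
   growth and finite second moments these Bochner integrals are proper (never the default 0). *)
definition cc_order ::
  "(real ^ 'n) set \<Rightarrow> (real ^ 'n) set \<Rightarrow> (real ^ 'n) measure \<Rightarrow> (real ^ 'n) measure \<Rightarrow> bool" where
  "cc_order V1 V2 \<mu> \<nu> \<longleftrightarrow>
     (\<forall>f. convex_concave V1 V2 f \<and> quadratic_growth f \<longrightarrow> (\<integral>x. f x \<partial>\<mu>) \<le> (\<integral>x. f x \<partial>\<nu>))"

definition u_quad :: "(real ^ 'n) set \<Rightarrow> (real ^ 'n) set \<Rightarrow> real ^ 'n \<Rightarrow> real" where
  "u_quad V1 V2 v = 1/2 * (norm (orth_proj V1 v))\<^sup>2 - 1/2 * (norm (orth_proj V2 v))\<^sup>2"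

end

theory Submission
  imports Defs
begin

text \<open>
  Write \<open>u\<close> for the quadratic function of an orthogonal splitting \<open>V1, V2\<close> and \<open>J\<close> for its gradient, the
  reflection in \<open>V1\<close>. If \<open>v\<close> has a 1-Lipschitz gradient, then \<open>u - v\<close> is convex-concave
  (\<open>u_quad_minus_admissible_cc\<close>), so the order tested on \<open>C11\<close> functions makes \<open>u\<close> optimal.

  Conversely, let \<open>u\<close> be optimal and \<open>f \<in> C11\<close> be convex-concave. Then \<open>J\<close> composed with the gradient of \<open>f\<close> is
  a monotone operator (\<open>saddle_gradient_monotone\<close>), so the gradient of \<open>u - e f\<close> is Lipschitz with constant
  \<open>sqrt (1 + e\<^sup>2 L\<^sup>2)\<close>, which is 1 to first order in \<open>e\<close> (\<open>perturbation_admissible\<close>). Comparing the rescaled function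
  with \<open>u\<close> for small \<open>e\<close> gives the order for \<open>f\<close> (\<open>C11_order_from_attains\<close>).

  To pass from \<open>C11\<close> test functions to all convex-concave functions of at most quadratic growth, such a
  function is approximated by its Moreau-Yosida saddle regularisations (\<open>C11_approximation\<close>): saddle
  points of the function plus a strongly convex-concave quadratic exist (\<open>saddle_exists\<close>) and
  depend on the centre of the quadratic in a nonexpansive way (\<open>saddle_nonexpansive\<close>), so the saddle value is a
  convex-concave \<open>C11\<close> function of the centre. It has a uniform quadratic bound and converges pointwise, and dominated
  convergence applies.

  Finally, a function whose gradient is an isometry is a quadratic polynomial whose linear gradient part is a symmetric
  orthogonal map (\<open>isometric_gradient_quadratic\<close>). That map is the reflection of the splitting into its
  eigenspaces for 1 and -1, so the function is \<open>u\<close> plus an affine function, and affine functions do not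
  distinguish measures with a common barycentre.
\<close>

section \<open>Gradients, C11 functions and optimality\<close>

lemma GDERIV_unique:
  assumes "GDERIV f x :> D" "GDERIV f x :> E"
  shows "D = E"
proof -
  have "(\<lambda>h. h \<bullet> D) = (\<lambda>h. h \<bullet> E)"
    using assms unfolding gderiv_def by (rule has_derivative_unique)
  then have "(D - E) \<bullet> D = (D - E) \<bullet> E" by metis
  then have "(D - E) \<bullet> (D - E) = 0" by (simp add: inner_diff_right)
  then show ?thesis by simp
qed

lemma gradient_eq: "GDERIV f x :> D \<Longrightarrow> gradient f x = D"
  unfolding gradient_def by (rule the_equality) (simp_all add: GDERIV_unique)

lemma differentiable_imp_GDERIV:
  fixes f :: "'a::euclidean_space \<Rightarrow> real"
  assumes "f differentiable (at x)"
  obtains D where "GDERIV f x :> D"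
proof -
  obtain f' where f': "(f has_derivative f') (at x)" using assms by (auto simp: differentiable_def)
  then have "linear f'" by (rule has_derivative_linear)
  then have "f' h = h \<bullet> adjoint f' 1" for h by (simp add: adjoint_works)
  then have "f' = (\<lambda>h. h \<bullet> adjoint f' 1)" by blast
  then show ?thesis using f' that unfolding gderiv_def by metis
qed

lemma GDERIV_gradient:
  assumes "f differentiable (at x)"
  shows "GDERIV f x :> gradient f x"
proof -
  obtain D where "GDERIV f x :> D" using differentiable_imp_GDERIV[OF assms] .
  then show ?thesis using gradient_eq[of f x D] by simp
qed

lemma C11I:
  assumes "\<And>x. GDERIV f x :> g x" "L-lipschitz_on UNIV g"
  shows "f \<in> C11" "gradient f = g"
proof -
  show g: "gradient f = g" using gradient_eq assms(1) by blast
  have "f differentiable (at x)" for x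
    using assms(1)[of x] unfolding gderiv_def differentiable_def by blast
  then show "f \<in> C11" using assms(2) by (auto simp: C11_def g)
qed

lemma C11D:
  assumes "f \<in> C11"
  shows "GDERIV f x :> gradient f x" "\<exists>L. L-lipschitz_on UNIV (gradient f)"
  using assms GDERIV_gradient[of f x] by (simp_all add: C11_def)

lemma lipschitz_on_normD:
  fixes g :: "'a::real_normed_vector \<Rightarrow> 'b::real_normed_vector"
  assumes "L-lipschitz_on UNIV g"
  shows "norm (g x - g y) \<le> L * norm (x - y)" "0 \<le> L"
  using lipschitz_onD[OF assms, of x y] lipschitz_on_nonneg[OF assms] by (simp_all add: dist_norm)

lemma lipschitz_on_norm_sqI:
  fixes g :: "'a::real_normed_vector \<Rightarrow> 'b::real_normed_vector"
  assumes "\<And>x y. (norm (g x - g y))\<^sup>2 \<le> L\<^sup>2 * (norm (x - y))\<^sup>2" "0 \<le> L"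
  shows "L-lipschitz_on UNIV g"
proof (rule lipschitz_onI)
  fix x y :: 'a
  have "(norm (g x - g y))\<^sup>2 \<le> (L * norm (x - y))\<^sup>2"
    using assms(1) by (simp add: power_mult_distrib)
  then have "norm (g x - g y) \<le> L * norm (x - y)"
    by (rule power2_le_imp_le) (simp add: assms(2))
  then show "dist (g x) (g y) \<le> L * dist x y" by (simp add: dist_norm)
qed (rule assms)

lemma GDERIV_along_line:
  assumes "\<And>z. GDERIV f z :> g z"
  shows "((\<lambda>t. f (x + t *\<^sub>R d)) has_real_derivative d \<bullet> g (x + t *\<^sub>R d)) (at t)"
proof -
  have "((\<lambda>t. f (x + t *\<^sub>R d)) has_derivative (\<lambda>h. (h *\<^sub>R d) \<bullet> g (x + t *\<^sub>R d))) (at t)"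
    by (rule has_derivative_compose[of "\<lambda>t. x + t *\<^sub>R d", OF _ assms[unfolded gderiv_def]])
      (auto intro!: derivative_eq_intros)
  then show ?thesis by (simp add: has_field_derivative_def mult.commute[of "d \<bullet> _"] mult_commute_abs)
qed

lemma lipschitz_gradient_upper:
  assumes g: "\<And>z. GDERIV f z :> g z" and L: "L-lipschitz_on UNIV g"
  shows "f y \<le> f x + g x \<bullet> (y - x) + L / 2 * (norm (y - x))\<^sup>2"
proof -
  define d where "d = y - x"
  define h where "h t = f (x + t *\<^sub>R d) - t * (d \<bullet> g x) - L / 2 * t\<^sup>2 * (norm d)\<^sup>2" for t
  have "h 1 \<le> h 0"
  proof (rule DERIV_nonpos_imp_nonincreasing[of 0 1 h])
    fix t :: real assume t: "0 \<le> t" "t \<le> 1"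
    have "(h has_real_derivative d \<bullet> g (x + t *\<^sub>R d) - d \<bullet> g x - L * t * (norm d)\<^sup>2) (at t)"
      unfolding h_def by (auto intro!: derivative_eq_intros GDERIV_along_line[OF g])
    moreover have "d \<bullet> g (x + t *\<^sub>R d) - d \<bullet> g x \<le> L * t * (norm d)\<^sup>2"
    proof -
      have "d \<bullet> g (x + t *\<^sub>R d) - d \<bullet> g x = d \<bullet> (g (x + t *\<^sub>R d) - g x)"
        by (simp add: inner_diff_right)
      also have "\<dots> \<le> norm d * norm (g (x + t *\<^sub>R d) - g x)" by (rule norm_cauchy_schwarz)
      also have "\<dots> \<le> norm d * (L * norm (x + t *\<^sub>R d - x))"
        by (intro mult_left_mono lipschitz_on_normD(1)[OF L]) simp
      also have "\<dots> = L * t * (norm d)\<^sup>2" using t by (simp add: power2_eq_square)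
      finally show ?thesis .
    qed
    ultimately show "\<exists>z. (h has_real_derivative z) (at t) \<and> z \<le> 0" by force
  qed simp
  then show ?thesis by (simp add: h_def d_def inner_commute)
qed

lemma lipschitz_gradient_lower:
  assumes g: "\<And>z. GDERIV f z :> g z" and L: "L-lipschitz_on UNIV g"
  shows "f x + g x \<bullet> (y - x) - L / 2 * (norm (y - x))\<^sup>2 \<le> f y"
proof -
  have "L-lipschitz_on UNIV (\<lambda>z. - g z)" using L by (simp add: lipschitz_on_def dist_minus)
  from lipschitz_gradient_upper[OF GDERIV_minus[OF g] this, of y x]
  show ?thesis by (simp add: algebra_simps)
qed

lemma C11_quadratic_growth:
  assumes "f \<in> C11"
  shows "quadratic_growth f"
proof -
  obtain L where L: "L-lipschitz_on UNIV (gradient f)" using C11D(2)[OF assms] by blast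
  define A where "A = \<bar>f 0\<bar> + (norm (gradient f 0))\<^sup>2"
  have A: "0 \<le> A" by (simp add: A_def)
  have L0: "0 \<le> L" using lipschitz_on_normD(2)[OF L] .
  have "\<bar>f x\<bar> \<le> (A + L + 1) * (1 + (norm x)\<^sup>2)" for x
  proof -
    let ?i = "gradient f 0 \<bullet> x"
    have "\<bar>?i\<bar> \<le> norm (gradient f 0) * norm x" by (rule Cauchy_Schwarz_ineq2)
    moreover have "2 * (norm (gradient f 0) * norm x) \<le> (norm (gradient f 0))\<^sup>2 + (norm x)\<^sup>2"
      using sum_squares_bound[of "norm (gradient f 0)" "norm x"] by (simp add: mult.assoc)
    ultimately have i: "\<bar>?i\<bar> \<le> (norm (gradient f 0))\<^sup>2 + (norm x)\<^sup>2"
      using zero_le_power2[of "norm (gradient f 0)"] zero_le_power2[of "norm x"] by linarith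
    have "\<bar>f x\<bar> \<le> \<bar>f 0\<bar> + \<bar>?i\<bar> + L / 2 * (norm x)\<^sup>2"
      using lipschitz_gradient_upper[OF C11D(1)[OF assms] L, of x 0]
        lipschitz_gradient_lower[OF C11D(1)[OF assms] L, of 0 x] by simp
    also have "\<dots> \<le> A + (norm x)\<^sup>2 + L / 2 * (norm x)\<^sup>2" using i by (simp add: A_def)
    also have "\<dots> \<le> A + (norm x)\<^sup>2 + L * (norm x)\<^sup>2"
      using L0 by (simp add: mult_right_mono)
    also have "\<dots> \<le> (A + L + 1) * (1 + (norm x)\<^sup>2)"
      using A L0 by (simp add: algebra_simps)
    finally show ?thesis .
  qed
  then show ?thesis unfolding quadratic_growth_def using A L0
    by (intro exI[of _ "A + L + 1"]) auto
qed

lemma P2_integrable_quadratic_bound: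
  assumes "\<mu> \<in> P2"
  shows "integrable \<mu> (\<lambda>x. C * (1 + (norm x)\<^sup>2))"
proof -
  interpret prob_space \<mu> using assms by (simp add: P2_def)
  show ?thesis using assms by (auto simp: P2_def)
qed

lemma P2_integrable:
  assumes "\<mu> \<in> P2" "f \<in> borel_measurable borel" "quadratic_growth f"
  shows "integrable \<mu> f"
proof -
  obtain C where "\<And>v. \<bar>f v\<bar> \<le> C * (1 + (norm v)\<^sup>2)"
    using assms(3) by (auto simp: quadratic_growth_def)
  moreover have "f \<in> borel_measurable \<mu>"
    using assms by (simp add: P2_def cong: measurable_cong_sets)
  ultimately show ?thesis
    by (intro Bochner_Integration.integrable_bound[OF P2_integrable_quadratic_bound[OF assms(1), of C]])
      (auto intro!: AE_I2 order_trans[OF _ abs_ge_self])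
qed

lemma C11_borel:
  assumes "f \<in> C11"
  shows "f \<in> borel_measurable borel"
proof (rule borel_measurable_continuous_onI)
  show "continuous_on UNIV f"
    using assms by (auto simp: C11_def intro!: continuous_at_imp_continuous_on differentiable_imp_continuous_within)
qed

lemma C11_integrable: "\<mu> \<in> P2 \<Longrightarrow> f \<in> C11 \<Longrightarrow> integrable \<mu> f"
  by (simp add: P2_integrable C11_borel C11_quadratic_growth)

lemma C11_lincomb:
  assumes f: "f \<in> C11" and g: "g \<in> C11"
  shows "(\<lambda>x. a * f x + b * g x) \<in> C11"
    "gradient (\<lambda>x. a * f x + b * g x) = (\<lambda>x. a *\<^sub>R gradient f x + b *\<^sub>R gradient g x)"
proof -
  obtain L M where "L-lipschitz_on UNIV (gradient f)" "M-lipschitz_on UNIV (gradient g)"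
    using C11D(2) f g by blast
  then have l: "(\<bar>a\<bar> * L + \<bar>b\<bar> * M)-lipschitz_on UNIV (\<lambda>x. a *\<^sub>R gradient f x + b *\<^sub>R gradient g x)"
    by (intro lipschitz_on_add lipschitz_on_cmult)
  have d: "GDERIV (\<lambda>x. a * f x + b * g x) x :> a *\<^sub>R gradient f x + b *\<^sub>R gradient g x" for x
    using GDERIV_add[OF GDERIV_mult[OF GDERIV_const[of a x] C11D(1)[OF f, of x]]
        GDERIV_mult[OF GDERIV_const[of b x] C11D(1)[OF g, of x]]] by simp
  show "(\<lambda>x. a * f x + b * g x) \<in> C11"
    "gradient (\<lambda>x. a * f x + b * g x) = (\<lambda>x. a *\<^sub>R gradient f x + b *\<^sub>R gradient g x)"
    using C11I[OF d l] by auto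
qed

lemma integral_diff_lincomb:
  assumes "\<mu> \<in> P2" "\<nu> \<in> P2" "f \<in> C11" "g \<in> C11"
  shows "integral_diff \<mu> \<nu> (\<lambda>x. a * f x + b * g x) = a * integral_diff \<mu> \<nu> f + b * integral_diff \<mu> \<nu> g"
  using C11_integrable[OF assms(1)] C11_integrable[OF assms(2)] assms(3,4)
  by (simp add: integral_diff_def algebra_simps)

lemma GDERIV_from_quadratic_error:
  fixes f :: "'a::real_inner \<Rightarrow> real"
  assumes "\<And>y. \<bar>f y - f x - D \<bullet> (y - x)\<bar> \<le> K * (norm (y - x))\<^sup>2"
  shows "GDERIV f x :> D"
  unfolding gderiv_def has_derivative_at
proof
  show "bounded_linear (\<lambda>h. h \<bullet> D)" by (rule bounded_linear_inner_left)
  have "((\<lambda>h. K * norm h) \<longlongrightarrow> 0) (at (0::'a))"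
    by (rule tendsto_mult_right_zero[OF tendsto_norm_zero[OF tendsto_ident_at]])
  moreover have "norm (norm (f (x + h) - f x - h \<bullet> D) / norm h) \<le> K * norm h" if "h \<noteq> 0" for h
    using assms[of "x + h"] that by (simp add: inner_commute divide_le_eq power2_eq_square mult_ac)
  ultimately show "((\<lambda>h. norm (f (x + h) - f x - h \<bullet> D) / norm h) \<longlongrightarrow> 0) (at 0)"
    by (elim Lim_null_comparison[rotated]) (auto simp: eventually_at_filter)
qed

lemma attains_I_iff:
  "attains_I \<mu> \<nu> u \<longleftrightarrow> u \<in> admissible \<and> (\<forall>v\<in>admissible. integral_diff \<mu> \<nu> v \<le> integral_diff \<mu> \<nu> u)"
proof -
  have "ereal (integral_diff \<mu> \<nu> u) = I_sup \<mu> \<nu> \<longleftrightarrow>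
      (\<forall>v\<in>admissible. integral_diff \<mu> \<nu> v \<le> integral_diff \<mu> \<nu> u)" if u: "u \<in> admissible"
  proof
    assume e: "ereal (integral_diff \<mu> \<nu> u) = I_sup \<mu> \<nu>"
    show "\<forall>v\<in>admissible. integral_diff \<mu> \<nu> v \<le> integral_diff \<mu> \<nu> u"
    proof
      fix v :: "real ^ 'a \<Rightarrow> real" assume "v \<in> admissible"
      then have "ereal (integral_diff \<mu> \<nu> v) \<le> I_sup \<mu> \<nu>" unfolding I_sup_def by (rule SUP_upper)
      then show "integral_diff \<mu> \<nu> v \<le> integral_diff \<mu> \<nu> u" unfolding e[symmetric] by simp
    qed
  next
    assume "\<forall>v\<in>admissible. integral_diff \<mu> \<nu> v \<le> integral_diff \<mu> \<nu> u"
    then show "ereal (integral_diff \<mu> \<nu> u) = I_sup \<mu> \<nu>"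
      unfolding I_sup_def using u by (intro antisym SUP_upper SUP_least) auto
  qed
  then show ?thesis by (auto simp: attains_I_def)
qed

section \<open>Orthogonal splittings and the quadratic function\<close>

lemma orth_proj_add_orthogonal:
  assumes "subspace W1" "\<And>v w. v \<in> W1 \<Longrightarrow> w \<in> W2 \<Longrightarrow> w \<bullet> v = 0" "v \<in> W1" "w \<in> W2"
  shows "orth_proj W1 (v + w) = v"
  unfolding orth_proj_def
proof (rule the_equality)
  show "v \<in> W1 \<and> (\<forall>u\<in>W1. orthogonal (v + w - v) u)" using assms by (auto simp: orthogonal_def)
  fix p assume p: "p \<in> W1 \<and> (\<forall>u\<in>W1. orthogonal (v + w - p) u)"
  then have m: "v - p \<in> W1" using assms(1,3) by (simp add: subspace_diff)
  then have "(v + w - p) \<bullet> (v - p) = 0" "w \<bullet> (v - p) = 0"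
    using p assms by (auto simp: orthogonal_def)
  then have "(v - p) \<bullet> (v - p) = 0" by (simp add: algebra_simps)
  then show "p = v" by simp
qed

lemma convex_on_from_tangents:
  fixes h :: "'a::real_inner \<Rightarrow> real"
  assumes "convex V" "\<And>x y. x \<in> V \<Longrightarrow> y \<in> V \<Longrightarrow> h x + s x \<bullet> (y - x) \<le> h y"
  shows "convex_on V h"
proof (rule convex_onI)
  fix t and x y :: 'a assume t: "0 < t" "t < (1::real)" and xy: "x \<in> V" "y \<in> V"
  define z where "z = (1 - t) *\<^sub>R x + t *\<^sub>R y"
  have z: "z \<in> V" using assms(1) xy t by (simp add: z_def convex_alt)
  have "(1 - t) * (h z + s z \<bullet> (x - z)) + t * (h z + s z \<bullet> (y - z)) \<le> (1 - t) * h x + t * h y"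
    using t xy z by (intro add_mono mult_left_mono assms(2)) auto
  moreover have "(1 - t) * (h z + s z \<bullet> (x - z)) + t * (h z + s z \<bullet> (y - z))
      = h z + s z \<bullet> ((1 - t) *\<^sub>R (x - z) + t *\<^sub>R (y - z))"
    by (simp add: inner_add_right algebra_simps)
  moreover have "(1 - t) *\<^sub>R (x - z) + t *\<^sub>R (y - z) = 0" by (simp add: z_def algebra_simps)
  ultimately show "h ((1 - t) *\<^sub>R x + t *\<^sub>R y) \<le> (1 - t) * h x + t * h y"
    by (simp add: z_def)
qed (rule assms)

text \<open>A differentiable function that is convex along a translate of the subspace \<open>V\<close> lies
  above its tangents in the directions of \<open>V\<close>.\<close>
lemma convex_tangent:
  assumes cvx: "convex_on V (\<lambda>x. f (x + y))" and V: "subspace V" and x: "x \<in> V" "x' \<in> V"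
    and g: "\<And>z. GDERIV f z :> g z"
  shows "f (x + y) + g (x + y) \<bullet> (x' - x) \<le> f (x' + y)"
proof -
  define k where "k t = f ((x + y) + t *\<^sub>R (x' - x))" for t
  have in_V: "x + t *\<^sub>R (x' - x) \<in> V" for t
    using x V by (simp add: subspace_add subspace_diff subspace_scale)
  have "convex_on UNIV k"
  proof (rule convex_onI)
    fix t s r :: real assume t: "0 < t" "t < 1"
    have "f (((1 - t) *\<^sub>R (x + s *\<^sub>R (x' - x)) + t *\<^sub>R (x + r *\<^sub>R (x' - x))) + y)
        \<le> (1 - t) * f (x + s *\<^sub>R (x' - x) + y) + t * f (x + r *\<^sub>R (x' - x) + y)"
      using convex_onD[OF cvx, of t, OF _ _ in_V in_V] t by auto
    moreover have "((1 - t) *\<^sub>R (x + s *\<^sub>R (x' - x)) + t *\<^sub>R (x + r *\<^sub>R (x' - x))) + y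
        = (x + y) + ((1 - t) *\<^sub>R s + t *\<^sub>R r) *\<^sub>R (x' - x)"
      by (simp add: algebra_simps)
    ultimately show "k ((1 - t) *\<^sub>R s + t *\<^sub>R r) \<le> (1 - t) * k s + t * k r"
      by (simp add: k_def add_ac)
  qed simp
  moreover have "(k has_field_derivative (x' - x) \<bullet> g (x + y)) (at 0 within UNIV)"
    using GDERIV_along_line[OF g, of "x + y" "x' - x" 0] by (simp add: k_def[abs_def])
  ultimately have "((x' - x) \<bullet> g (x + y)) * (1 - 0) \<le> k 1 - k 0"
    by (intro convex_on_imp_above_tangent[of UNIV]) auto
  then show ?thesis by (simp add: k_def inner_commute algebra_simps)
qed

text \<open>An orthogonal decomposition of the space into \<open>V1\<close> and \<open>V2\<close>, with projections \<open>P\<close> and \<open>Q\<close>.\<close>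
locale splitting =
  fixes V1 V2 :: "(real ^ 'n) set"
  assumes mc: "mutually_complementing V1 V2" and orth: "orthogonal_sets V1 V2"
begin

abbreviation "P \<equiv> orth_proj V1"
abbreviation "Q \<equiv> orth_proj V2"

lemma sub: "subspace V1" "subspace V2"
  using mc by (auto simp: mutually_complementing_def)

lemma inner_zero: "v \<in> V1 \<Longrightarrow> w \<in> V2 \<Longrightarrow> v \<bullet> w = 0" "v \<in> V1 \<Longrightarrow> w \<in> V2 \<Longrightarrow> w \<bullet> v = 0"
  using orth by (auto simp: orthogonal_sets_def orthogonal_def inner_commute)

lemma proj_sum:
  assumes "v \<in> V1" "w \<in> V2"
  shows "P (v + w) = v" "Q (v + w) = w"
proof -
  show "P (v + w) = v"
    by (rule orth_proj_add_orthogonal[OF sub(1) inner_zero(2) assms])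
  show "Q (v + w) = w"
    unfolding add.commute[of v w] by (rule orth_proj_add_orthogonal[OF sub(2) inner_zero(1) assms(2,1)])
qed

lemma decomp: "P x \<in> V1" "Q x \<in> V2" "P x + Q x = x"
proof -
  have "x \<in> {v1 + v2 |v1 v2. v1 \<in> V1 \<and> v2 \<in> V2}"
    using mc by (simp add: mutually_complementing_def)
  then obtain v w where "v \<in> V1" "w \<in> V2" "x = v + w" by blast
  then show "P x \<in> V1" "Q x \<in> V2" "P x + Q x = x" by (simp_all add: proj_sum)
qed

lemma proj_in: "v \<in> V1 \<Longrightarrow> P v = v" "v \<in> V1 \<Longrightarrow> Q v = 0" "w \<in> V2 \<Longrightarrow> Q w = w" "w \<in> V2 \<Longrightarrow> P w = 0"
  using proj_sum[of v 0] proj_sum[of 0 w] sub by (simp_all add: subspace_0)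

lemma linear_P: "linear P" and linear_Q: "linear Q"
proof -
  have a: "P (x + y) = P x + P y" "Q (x + y) = Q x + Q y" for x y
  proof -
    have e: "x + y = (P x + P y) + (Q x + Q y)"
      using decomp(3)[of x] decomp(3)[of y] by (metis add.assoc add.left_commute)
    have "P x + P y \<in> V1" "Q x + Q y \<in> V2" using sub decomp by (auto simp: subspace_add)
    from proj_sum[OF this, folded e] show "P (x + y) = P x + P y" "Q (x + y) = Q x + Q y" .
  qed
  have s: "P (c *\<^sub>R x) = c *\<^sub>R P x" "Q (c *\<^sub>R x) = c *\<^sub>R Q x" for c x
  proof -
    have e: "c *\<^sub>R x = c *\<^sub>R P x + c *\<^sub>R Q x"
      using decomp(3)[of x] by (metis scaleR_add_right)
    have "c *\<^sub>R P x \<in> V1" "c *\<^sub>R Q x \<in> V2" using sub decomp by (auto simp: subspace_scale)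
    from proj_sum[OF this, folded e] show "P (c *\<^sub>R x) = c *\<^sub>R P x" "Q (c *\<^sub>R x) = c *\<^sub>R Q x" .
  qed
  show "linear P" "linear Q" using a s by (auto intro!: linearI)
qed

lemmas proj_add = linear_add[OF linear_P] linear_add[OF linear_Q]
lemmas proj_diff = linear_diff[OF linear_P] linear_diff[OF linear_Q]
lemmas proj_scale = linear_scale[OF linear_P] linear_scale[OF linear_Q]

lemma inner_split: "x \<bullet> y = P x \<bullet> P y + Q x \<bullet> Q y"
proof -
  have "x \<bullet> y = (P x + Q x) \<bullet> (P y + Q y)" by (simp add: decomp)
  also have "\<dots> = P x \<bullet> P y + Q x \<bullet> Q y"
    by (simp add: inner_add_left inner_add_right inner_zero decomp(1,2))
  finally show ?thesis .
qed

lemma norm_split: "(norm x)\<^sup>2 = (norm (P x))\<^sup>2 + (norm (Q x))\<^sup>2"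
  using inner_split[of x x] by (simp add: power2_norm_eq_inner)

lemma inner_proj: "P x \<bullet> y = P x \<bullet> P y" "Q x \<bullet> y = Q x \<bullet> Q y"
  using inner_split[of "P x" y] inner_split[of "Q x" y] by (simp_all add: proj_in decomp)

text \<open>The reflection that fixes \<open>V1\<close> and negates \<open>V2\<close>; it is the gradient of \<open>u_quad V1 V2\<close>.\<close>
definition J :: "real ^ 'n \<Rightarrow> real ^ 'n" where "J x = P x - Q x"

lemma J_diff: "J (x - y) = J x - J y"
  by (simp add: J_def proj_diff)

lemma J_inner: "J x \<bullet> y = P x \<bullet> P y - Q x \<bullet> Q y"
  by (simp only: J_def inner_diff_left inner_proj[of x y])

lemma norm_J: "(norm (J x))\<^sup>2 = (norm x)\<^sup>2"
  using norm_split[of "J x"] norm_split[of x] by (simp add: J_def proj_diff proj_in decomp)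

lemma norm_J_eq: "norm (J x) = norm x"
  using norm_J by (simp add: power2_eq_iff_nonneg)

lemma u_quad_eq: "u_quad V1 V2 x = 1 / 2 * (J x \<bullet> x)"
  by (simp add: u_quad_def J_inner power2_norm_eq_inner algebra_simps)

lemma GDERIV_u_quad: "GDERIV (u_quad V1 V2) x :> J x"
proof (rule GDERIV_from_quadratic_error)
  fix y
  have "u_quad V1 V2 y - u_quad V1 V2 x - J x \<bullet> (y - x) = 1 / 2 * (J (y - x) \<bullet> (y - x))"
    unfolding u_quad_eq J_inner
    by (simp add: proj_diff algebra_simps inner_commute)
  also have "\<bar>\<dots>\<bar> \<le> 1 / 2 * (norm (J (y - x)) * norm (y - x))"
    using Cauchy_Schwarz_ineq2[of "J (y - x)" "y - x"] by (simp add: abs_mult)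
  finally show "\<bar>u_quad V1 V2 y - u_quad V1 V2 x - J x \<bullet> (y - x)\<bar> \<le> 1 / 2 * (norm (y - x))\<^sup>2"
    by (simp add: norm_J_eq power2_eq_square)
qed

lemma J_lipschitz: "1-lipschitz_on UNIV J"
  by (rule lipschitz_onI) (simp_all add: dist_norm norm_J_eq flip: J_diff)

lemma u_quad_C11: "u_quad V1 V2 \<in> C11" and gradient_u_quad: "gradient (u_quad V1 V2) = J"
  by (rule C11I[OF GDERIV_u_quad J_lipschitz])+

lemma u_quad_admissible: "u_quad V1 V2 \<in> admissible"
  by (simp add: admissible_def u_quad_C11 gradient_u_quad J_lipschitz)

lemma isometry_J: "isometry J"
  by (simp add: isometry_def dist_norm norm_J_eq flip: J_diff)

text \<open>A 1-Lipschitz gradient makes both \<open>(norm x)\<^sup>2 / 2 - v x\<close> and \<open>(norm x)\<^sup>2 / 2 + v x\<close> convex; the former is used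
  on \<open>V1\<close> and the latter on \<open>V2\<close>.\<close>
lemma u_quad_minus_admissible_cc:
  assumes "v \<in> admissible"
  shows "convex_concave V1 V2 (\<lambda>x. u_quad V1 V2 x - v x)"
proof -
  have g: "GDERIV v x :> gradient v x" for x
    using assms C11D(1) by (auto simp: admissible_def)
  have l: "1-lipschitz_on UNIV (gradient v)" using assms by (simp add: admissible_def)
  note up = lipschitz_gradient_upper[OF g l] and lo = lipschitz_gradient_lower[OF g l]
  have u: "u_quad V1 V2 (x + y) = 1 / 2 * (x \<bullet> x) - 1 / 2 * (y \<bullet> y)" if "x \<in> V1" "y \<in> V2" for x y
    using that by (simp add: u_quad_def proj_sum power2_norm_eq_inner)
  have "convex_on V1 (\<lambda>x. u_quad V1 V2 (x + y) - v (x + y))" if y: "y \<in> V2" for y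
  proof (rule convex_on_from_tangents[where s = "\<lambda>x. x - gradient v (x + y)"])
    fix x x' assume "x \<in> V1" "x' \<in> V1"
    then show "u_quad V1 V2 (x + y) - v (x + y) + (x - gradient v (x + y)) \<bullet> (x' - x)
        \<le> u_quad V1 V2 (x' + y) - v (x' + y)"
      using up[of "x' + y" "x + y"] y
      by (simp add: u power2_norm_eq_inner inner_commute algebra_simps)
  qed (simp add: sub subspace_imp_convex)
  moreover have "convex_on V2 (\<lambda>y. - (u_quad V1 V2 (x + y) - v (x + y)))" if x: "x \<in> V1" for x
  proof (rule convex_on_from_tangents[where s = "\<lambda>y. y + gradient v (x + y)"])
    fix y y' assume "y \<in> V2" "y' \<in> V2"
    then show "- (u_quad V1 V2 (x + y) - v (x + y)) + (y + gradient v (x + y)) \<bullet> (y' - y)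
        \<le> - (u_quad V1 V2 (x + y') - v (x + y'))"
      using lo[of "x + y" "x + y'"] x
      by (simp add: u power2_norm_eq_inner inner_commute algebra_simps)
  qed (simp add: sub subspace_imp_convex)
  ultimately show ?thesis by (simp add: convex_concave_def concave_on_def)
qed

text \<open>For a differentiable convex-concave function, the gradient with its \<open>V2\<close>-component negated is a monotone
  operator: add the four tangent inequalities between the corners of the rectangle spanned by \<open>x\<close> and \<open>y\<close>.\<close>
lemma saddle_gradient_monotone:
  assumes cc: "convex_concave V1 V2 f" and g: "\<And>z. GDERIV f z :> g z"
  shows "0 \<le> J (x - y) \<bullet> (g x - g y)"
proof -
  have 1: "f (a + b) + g (a + b) \<bullet> (a' - a) \<le> f (a' + b)" if "a \<in> V1" "a' \<in> V1" "b \<in> V2" for a a' b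
    using convex_tangent[of V1 f b a a' g] that cc g sub by (simp add: convex_concave_def)
  have 2: "f (a + b') \<le> f (a + b) + g (a + b) \<bullet> (b' - b)" if "a \<in> V1" "b \<in> V2" "b' \<in> V2" for a b b'
  proof -
    have "convex_on V2 (\<lambda>b. - f (b + a))"
      using cc that by (simp add: convex_concave_def concave_on_def add.commute[of _ a])
    from convex_tangent[of V2 "\<lambda>x. - f x" a b b' "\<lambda>x. - g x", OF this sub(2) that(2,3) GDERIV_minus[OF g]]
    show ?thesis by (simp add: add.commute)
  qed
  note d = decomp(1,2)
  have "g x \<bullet> (P y - P x) + g y \<bullet> (P x - P y) \<le> g x \<bullet> (Q y - Q x) + g y \<bullet> (Q x - Q y)"
    using 1[of "P x" "P y" "Q x"] 1[of "P y" "P x" "Q y"]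
      2[of "P x" "Q x" "Q y"] 2[of "P y" "Q y" "Q x"] by (simp add: d decomp(3))
  then show ?thesis by (simp add: J_def proj_diff algebra_simps inner_commute)
qed

end

section \<open>Strong convexity and coercivity\<close>

lemma norm_sq_combo:
  fixes u v :: "'a::real_inner"
  shows "(norm ((1 - t) *\<^sub>R u + t *\<^sub>R v))\<^sup>2
    = (1 - t) * (norm u)\<^sup>2 + t * (norm v)\<^sup>2 - t * (1 - t) * (norm (u - v))\<^sup>2"
  by (simp add: power2_norm_eq_inner algebra_simps inner_commute)

lemma norm_sq_le_double:
  fixes x y :: "'a::real_inner"
  shows "(norm x)\<^sup>2 \<le> 2 * (norm (x - y))\<^sup>2 + 2 * (norm y)\<^sup>2"
proof -
  have "0 \<le> (norm (x - 2 *\<^sub>R y))\<^sup>2" by simp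
  then show ?thesis
    by (simp add: power2_norm_eq_inner algebra_simps inner_commute)
qed

lemma coercive_attains_inf:
  fixes g :: "'a::euclidean_space \<Rightarrow> real"
  assumes cont: "continuous_on UNIV g" and k: "0 < k"
    and low: "\<And>x. k * (norm (x - b))\<^sup>2 - K \<le> g x"
  obtains m where "\<And>x. g m \<le> g x"
proof -
  define R where "R = sqrt (max 0 ((g b + K) / k))"
  have R0: "0 \<le> R" and R2: "R\<^sup>2 = max 0 ((g b + K) / k)"
    by (simp_all add: R_def)
  have "compact (cball b R)" "cball b R \<noteq> {}" using R0 by auto
  then obtain m where m: "m \<in> cball b R" "\<And>y. y \<in> cball b R \<Longrightarrow> g m \<le> g y"
    using continuous_attains_inf[of "cball b R" g] cont continuous_on_subset by blast
  have "g m \<le> g x" for x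
  proof (cases "x \<in> cball b R")
    case False
    then have "R \<le> norm (x - b)" by (simp add: dist_norm norm_minus_commute)
    then have "R\<^sup>2 \<le> (norm (x - b))\<^sup>2" using R0 by (simp add: power_mono)
    then have "(g b + K) / k \<le> (norm (x - b))\<^sup>2" using R2 by simp
    then have "g b + K \<le> k * (norm (x - b))\<^sup>2" using k by (simp add: field_simps)
    then have "g b \<le> g x" using low[of x] by linarith
    moreover have "g m \<le> g b" using m(2)[of b] R0 by simp
    ultimately show ?thesis by linarith
  qed (use m in auto)
  then show ?thesis using that by blast
qed

text \<open>A minimiser of a convex function plus \<open>c (norm (x - a))\<^sup>2\<close> is a minimiser with quadratic margin \<open>c\<close>:
  compare with the points \<open>(1 - t) m + t x\<close>, divide by \<open>t\<close> and let \<open>t\<close> tend to 0.\<close>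
lemma strongly_convex_min:
  fixes g :: "'a::real_inner \<Rightarrow> real"
  assumes cvx: "convex_on UNIV g"
    and min: "\<And>x. g m + c * (norm (m - a))\<^sup>2 \<le> g x + c * (norm (x - a))\<^sup>2"
  shows "g m + c * (norm (m - a))\<^sup>2 + c * (norm (x - m))\<^sup>2 \<le> g x + c * (norm (x - a))\<^sup>2"
proof -
  define h where "h x = g x + c * (norm (x - a))\<^sup>2" for x
  have *: "h m + (1 - t) * (c * (norm (x - m))\<^sup>2) \<le> h x" if t: "0 < t" "t < 1" for t
  proof -
    have e: "(1 - t) *\<^sub>R m + t *\<^sub>R x - a = (1 - t) *\<^sub>R (m - a) + t *\<^sub>R (x - a)"
      by (simp add: algebra_simps)
    have "h m \<le> h ((1 - t) *\<^sub>R m + t *\<^sub>R x)" using min by (simp add: h_def)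
    also have "\<dots> \<le> (1 - t) * g m + t * g x + c * ((1 - t) * (norm (m - a))\<^sup>2
        + t * (norm (x - a))\<^sup>2 - t * (1 - t) * (norm (m - x))\<^sup>2)"
      unfolding h_def e norm_sq_combo using convex_onD[OF cvx, of t m x] t
      by (simp add: algebra_simps)
    also have "\<dots> = (1 - t) * h m + t * h x - t * ((1 - t) * (c * (norm (x - m))\<^sup>2))"
      by (simp add: h_def algebra_simps norm_minus_commute)
    finally have "t * (h m + (1 - t) * (c * (norm (x - m))\<^sup>2)) \<le> t * h x"
      by (simp add: algebra_simps)
    then show ?thesis using t by simp
  qed
  have "((\<lambda>t. h m + (1 - t) * (c * (norm (x - m))\<^sup>2)) \<longlongrightarrow> h m + (1 - 0) * (c * (norm (x - m))\<^sup>2))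
      (at_right 0)"
    by (intro tendsto_intros)
  moreover have "eventually (\<lambda>t. h m + (1 - t) * (c * (norm (x - m))\<^sup>2) \<le> h x) (at_right (0::real))"
    using * by (auto simp: eventually_at_right_field intro!: exI[of _ 1])
  ultimately have "h m + (1 - 0) * (c * (norm (x - m))\<^sup>2) \<le> h x"
    by (rule tendsto_upperbound) simp
  then show ?thesis by (simp add: h_def)
qed

section \<open>Saddle regularisation of convex-concave functions\<close>

text \<open>Finite convex-concave functions on a product of two full Euclidean spaces, with a fixed constant
  of quadratic growth. Interchanging the two variables and changing the sign maps the class to itself
  (lemma \<open>swap\<close> below), so that each statement about one variable or one bound yields the other one.\<close>
locale saddle_function =
  fixes F :: "'a::euclidean_space \<Rightarrow> 'b::euclidean_space \<Rightarrow> real" and C :: real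
  assumes cvx: "\<And>q. convex_on UNIV (\<lambda>p. F p q)"
    and ccv: "\<And>p. concave_on UNIV (F p)"
    and growth: "\<And>p q. \<bar>F p q\<bar> \<le> C * (1 + (norm p)\<^sup>2 + (norm q)\<^sup>2)"
begin

text \<open>The function \<open>(p, q) \<mapsto> F p q\<close> with a strongly convex-concave quadratic added at centre \<open>(a, b)\<close>. Its
  saddle value, as a function of \<open>(a, b)\<close>, is the Moreau-Yosida regularisation of \<open>F\<close>; the
  parameter \<open>c\<close> corresponds to \<open>1 / (2 \<lambda>)\<close> in the usual notation, so \<open>c\<close> tends to infinity.\<close>
definition Phi :: "real \<Rightarrow> 'a \<Rightarrow> 'b \<Rightarrow> 'a \<Rightarrow> 'b \<Rightarrow> real" where
  "Phi c a b p q = F p q + c * (norm (p - a))\<^sup>2 - c * (norm (q - b))\<^sup>2"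

text \<open>\<open>(p, q)\<close> is a saddle point of \<open>Phi c a b\<close>: \<open>p\<close> minimises, \<open>q\<close> maximises.\<close>
definition is_saddle :: "real \<Rightarrow> 'a \<Rightarrow> 'b \<Rightarrow> 'a \<Rightarrow> 'b \<Rightarrow> bool" where
  "is_saddle c a b p q \<longleftrightarrow>
    (\<forall>y. Phi c a b p y \<le> Phi c a b p q) \<and> (\<forall>x. Phi c a b p q \<le> Phi c a b x q)"

lemma C_nonneg: "0 \<le> C"
  using order_trans[OF abs_ge_zero growth[of 0 0]] by simp

lemma convex_neg: "convex_on UNIV (\<lambda>q. - F p q)"
  using ccv by (simp add: concave_on_def)

lemma swap: "saddle_function (\<lambda>q p. - F p q) C"
proof
  show "convex_on UNIV (\<lambda>q. - F p q)" for p by (rule convex_neg)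
  show "concave_on UNIV (\<lambda>p. - F p q)" for q using cvx by (simp add: concave_on_def)
  show "\<bar>- F p q\<bar> \<le> C * (1 + (norm q)\<^sup>2 + (norm p)\<^sup>2)" for p q
    using growth[of p q] by (simp add: algebra_simps)
qed

lemma Phi_swap: "saddle_function.Phi (\<lambda>q p. - F p q) c b a q p = - Phi c a b p q"
  by (simp add: saddle_function.Phi_def[OF swap] Phi_def)

lemma saddle_swap:
  "saddle_function.is_saddle (\<lambda>q p. - F p q) c b a q p \<longleftrightarrow> is_saddle c a b p q"
  by (auto simp: saddle_function.is_saddle_def[OF swap] is_saddle_def Phi_swap)

lemma continuous_left: "continuous_on UNIV (\<lambda>p. F p q)"
  by (rule convex_on_continuous[OF open_UNIV cvx])

lemma continuous_right: "continuous_on UNIV (F p)"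
  using continuous_on_minus[OF convex_on_continuous[OF open_UNIV convex_neg[of p]]] by simp

lemma lower_coercive:
  assumes "2 * C < c"
  shows "(c - 2 * C) * (norm (p - a))\<^sup>2 - C * (1 + 2 * (norm a)\<^sup>2 + (norm q)\<^sup>2)
     \<le> F p q + c * (norm (p - a))\<^sup>2"
proof -
  have "C * (norm p)\<^sup>2 \<le> C * (2 * (norm (p - a))\<^sup>2 + 2 * (norm a)\<^sup>2)"
    by (rule mult_left_mono[OF norm_sq_le_double C_nonneg])
  then show ?thesis using growth[of p q] by (simp add: algebra_simps)
qed

lemma min_exists:
  assumes "2 * C < c"
  obtains m where "\<And>x. F m q + c * (norm (m - a))\<^sup>2 \<le> F x q + c * (norm (x - a))\<^sup>2"
proof (rule coercive_attains_inf[of "\<lambda>p. F p q + c * (norm (p - a))\<^sup>2" "c - 2 * C" a])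
  show "continuous_on UNIV (\<lambda>p. F p q + c * (norm (p - a))\<^sup>2)"
    by (intro continuous_intros continuous_left)
  show "0 < c - 2 * C" using assms by simp
  show "(c - 2 * C) * (norm (p - a))\<^sup>2 - C * (1 + 2 * (norm a)\<^sup>2 + (norm q)\<^sup>2)
      \<le> F p q + c * (norm (p - a))\<^sup>2" for p
    by (rule lower_coercive[OF assms])
qed (use that in blast)

lemma max_exists:
  assumes "2 * C < c"
  obtains m where "\<And>y. F p y - c * (norm (y - b))\<^sup>2 \<le> F p m - c * (norm (m - b))\<^sup>2"
proof -
  obtain m where m: "\<And>y. - F p m + c * (norm (m - b))\<^sup>2 \<le> - F p y + c * (norm (y - b))\<^sup>2"
    using saddle_function.min_exists[OF swap assms, of p b] by blast
  have "F p y - c * (norm (y - b))\<^sup>2 \<le> F p m - c * (norm (m - b))\<^sup>2" for y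
    using m[of y] by linarith
  then show ?thesis using that by blast
qed

lemma min_strong:
  assumes "\<And>x. Phi c a b p q \<le> Phi c a b x q"
  shows "Phi c a b p q + c * (norm (x - p))\<^sup>2 \<le> Phi c a b x q"
  using strongly_convex_min[OF cvx[of q], of p c a x] assms by (simp add: Phi_def)

lemma max_strong:
  assumes "\<And>y. Phi c a b p y \<le> Phi c a b p q"
  shows "Phi c a b p y \<le> Phi c a b p q - c * (norm (y - q))\<^sup>2"
  using saddle_function.min_strong[OF swap, of c b a q p y] assms by (simp add: Phi_swap)

lemma Phi_convex:
  assumes "0 \<le> c" "0 \<le> t" "t \<le> 1"
  shows "Phi c ((1 - t) *\<^sub>R a + t *\<^sub>R a') b ((1 - t) *\<^sub>R p + t *\<^sub>R p') q
    \<le> (1 - t) * Phi c a b p q + t * Phi c a' b p' q"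
proof -
  have e: "((1 - t) *\<^sub>R p + t *\<^sub>R p') - ((1 - t) *\<^sub>R a + t *\<^sub>R a')
      = (1 - t) *\<^sub>R (p - a) + t *\<^sub>R (p' - a')"
    by (simp add: algebra_simps)
  have "0 \<le> c * (t * (1 - t) * (norm (p - a - (p' - a')))\<^sup>2)" using assms by simp
  then show ?thesis
    unfolding Phi_def e norm_sq_combo using convex_onD[OF cvx[of q] assms(2,3), of p p']
    by (simp add: algebra_simps)
qed

text \<open>The maximum over \<open>q\<close> is a convex coercive function \<open>\<theta>\<close> of \<open>p\<close>; let \<open>p0\<close> minimise it and let \<open>q0\<close> be
  the maximiser at \<open>p0\<close>. Moving from \<open>p0\<close> a fraction \<open>t\<close> towards any \<open>x\<close>, minimality of \<open>p0\<close>
  bounds \<open>\<theta> p0\<close> by the value at \<open>x\<close> and the moved maximiser; the strong concavity makes that maximiser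
  converge to \<open>q0\<close> as \<open>t\<close> tends to 0. No minimax theorem is needed.\<close>
lemma saddle_exists:
  assumes c: "2 * C < c"
  shows "\<exists>p q. is_saddle c a b p q"
proof -
  have c0: "0 < c" using c C_nonneg by linarith
  let ?Phi = "Phi c a b"
  have "\<exists>q. \<forall>y. ?Phi p y \<le> ?Phi p q" for p
  proof -
    obtain m where "\<And>y. F p y - c * (norm (y - b))\<^sup>2 \<le> F p m - c * (norm (m - b))\<^sup>2"
      using max_exists[OF c] by blast
    then have "\<forall>y. ?Phi p y \<le> ?Phi p m" by (simp add: Phi_def algebra_simps)
    then show ?thesis by blast
  qed
  then obtain Q where Q: "\<And>p y. ?Phi p y \<le> ?Phi p (Q p)" by metis
  define \<theta> where "\<theta> p = ?Phi p (Q p)" for p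
  have split: "?Phi ((1 - t) *\<^sub>R p + t *\<^sub>R p') y \<le> (1 - t) * ?Phi p y + t * ?Phi p' y"
    if "0 \<le> t" "t \<le> 1" for t p p' y
    using Phi_convex[of c t a a b p p' y] that c0 by (simp add: algebra_simps)
  have "convex_on UNIV \<theta>"
  proof (rule convex_onI)
    fix t and x y :: 'a assume t: "0 < t" "t < (1::real)"
    let ?z = "(1 - t) *\<^sub>R x + t *\<^sub>R y"
    have "\<theta> ?z \<le> (1 - t) * ?Phi x (Q ?z) + t * ?Phi y (Q ?z)"
      using split t by (simp add: \<theta>_def)
    also have "\<dots> \<le> (1 - t) * \<theta> x + t * \<theta> y"
      using t Q by (intro add_mono mult_left_mono) (auto simp: \<theta>_def)
    finally show "\<theta> ?z \<le> (1 - t) * \<theta> x + t * \<theta> y" .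
  qed simp
  then have "continuous_on UNIV \<theta>" by (rule convex_on_continuous[OF open_UNIV])
  moreover have "(c - 2 * C) * (norm (p - a))\<^sup>2 - C * (1 + 2 * (norm a)\<^sup>2 + (norm b)\<^sup>2) \<le> \<theta> p" for p
    using lower_coercive[OF c, of p a b] Q[of p b] by (simp add: \<theta>_def Phi_def)
  ultimately obtain p0 where p0: "\<And>x. \<theta> p0 \<le> \<theta> x"
    using coercive_attains_inf[of \<theta> "c - 2 * C" a] c by (metis diff_gt_0_iff_gt)
  define q0 where "q0 = Q p0"
  have "?Phi p0 q0 \<le> ?Phi x q0" for x
  proof -
    define pt where "pt t = (1 - t) *\<^sub>R p0 + t *\<^sub>R x" for t
    define qt where "qt t = Q (pt t)" for t
    have key: "\<theta> p0 \<le> ?Phi x (qt t) - ((1 - t) / t) * (c * (norm (qt t - q0))\<^sup>2)"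
      if t: "0 < t" "t < 1" for t
    proof -
      have "\<theta> p0 \<le> ?Phi (pt t) (qt t)" using p0[of "pt t"] by (simp add: \<theta>_def qt_def)
      also have "\<dots> \<le> (1 - t) * ?Phi p0 (qt t) + t * ?Phi x (qt t)"
        unfolding pt_def using split t by simp
      also have "\<dots> \<le> (1 - t) * (\<theta> p0 - c * (norm (qt t - q0))\<^sup>2) + t * ?Phi x (qt t)"
        using max_strong[OF Q[of p0], of "qt t"] t
        by (intro add_mono mult_left_mono) (auto simp: \<theta>_def q0_def)
      finally have "t * \<theta> p0 \<le> t * ?Phi x (qt t) - (1 - t) * (c * (norm (qt t - q0))\<^sup>2)"
        by (simp add: algebra_simps)
      also have "\<dots> = t * (?Phi x (qt t) - ((1 - t) / t) * (c * (norm (qt t - q0))\<^sup>2))"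
        using t by (simp add: field_simps)
      finally show ?thesis using t by simp
    qed
    define s where "s n = 1 / (real n + 2)" for n
    have s: "0 < s n" "s n < 1" "(1 - s n) / s n = real n + 1" for n
      by (simp_all add: s_def field_simps)
    have near: "(norm (qt (s n) - q0))\<^sup>2 \<le> ((\<theta> x - \<theta> p0) / c) * (1 / (real n + 1))" for n
    proof -
      have "(real n + 1) * (c * (norm (qt (s n) - q0))\<^sup>2) \<le> \<theta> x - \<theta> p0"
        using key[of "s n"] Q[of x "qt (s n)"] s[of n] by (simp add: \<theta>_def)
      then have "(norm (qt (s n) - q0))\<^sup>2 * (c * (real n + 1)) \<le> \<theta> x - \<theta> p0"
        by (simp add: mult_ac)
      moreover have "0 < c * (real n + 1)" using c0 by simp
      ultimately show ?thesis by (simp add: pos_le_divide_eq del: mult_pos_pos)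
    qed
    have "(\<lambda>n. ((\<theta> x - \<theta> p0) / c) * (1 / (real n + 1))) \<longlonglongrightarrow> ((\<theta> x - \<theta> p0) / c) * 0"
      using LIMSEQ_inverse_real_of_nat
      by (intro tendsto_intros) (simp add: inverse_eq_divide add.commute)
    then have up: "(\<lambda>n. ((\<theta> x - \<theta> p0) / c) * (1 / (real n + 1))) \<longlonglongrightarrow> 0"
      by (simp only: mult_zero_right)
    have "(\<lambda>n. (norm (qt (s n) - q0))\<^sup>2) \<longlonglongrightarrow> 0"
      by (rule tendsto_sandwich[OF _ _ tendsto_const up]) (simp_all only: near zero_le_power2 eventually_True)
    then have "(\<lambda>n. sqrt ((norm (qt (s n) - q0))\<^sup>2)) \<longlonglongrightarrow> sqrt 0" by (rule tendsto_real_sqrt)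
    then have "(\<lambda>n. norm (qt (s n) - q0)) \<longlonglongrightarrow> 0" by simp
    then have lim: "(\<lambda>n. qt (s n)) \<longlonglongrightarrow> q0"
      by (rule LIM_zero_cancel[OF tendsto_norm_zero_cancel])
    have "continuous_on UNIV (?Phi x)"
      unfolding Phi_def by (intro continuous_intros continuous_right)
    then have "(\<lambda>n. ?Phi x (qt (s n))) \<longlonglongrightarrow> ?Phi x q0"
      by (rule continuous_on_tendsto_compose[OF _ lim]) simp_all
    moreover have "\<theta> p0 \<le> ?Phi x (qt (s n))" for n
    proof -
      have "0 \<le> ((1 - s n) / s n) * (c * (norm (qt (s n) - q0))\<^sup>2)"
        using s c0 by simp
      then show ?thesis using key[of "s n"] s[of n] by linarith
    qed
    ultimately have "\<theta> p0 \<le> ?Phi x q0" by (intro LIMSEQ_le_const) auto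
    then show ?thesis by (simp add: \<theta>_def q0_def)
  qed
  then have "is_saddle c a b p0 q0" using Q by (simp add: is_saddle_def q0_def)
  then show ?thesis by blast
qed

text \<open>The saddle point is the resolvent of a monotone operator, hence nonexpansive in the centre. Here this
  follows by adding the four strong optimality inequalities, in which all values of \<open>F\<close> cancel.\<close>
lemma saddle_nonexpansive:
  assumes c: "0 < c" and s: "is_saddle c a b p q" and s': "is_saddle c a' b' p' q'"
  shows "(norm (p' - p))\<^sup>2 + (norm (q' - q))\<^sup>2 \<le> (norm (a' - a))\<^sup>2 + (norm (b' - b))\<^sup>2"
proof -
  have "Phi c a b p q + c * (norm (p' - p))\<^sup>2 \<le> Phi c a b p' q"
    "Phi c a' b' p' q' + c * (norm (p - p'))\<^sup>2 \<le> Phi c a' b' p q'"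
    using s s' by (auto simp: is_saddle_def intro!: min_strong)
  moreover have "Phi c a b p q' \<le> Phi c a b p q - c * (norm (q' - q))\<^sup>2"
    "Phi c a' b' p' q \<le> Phi c a' b' p' q' - c * (norm (q - q'))\<^sup>2"
    using s s' by (auto simp: is_saddle_def intro!: max_strong)
  ultimately have "c * ((norm (p' - p))\<^sup>2 + (norm (q' - q))\<^sup>2)
      \<le> c * ((p' - p) \<bullet> (a' - a) + (q' - q) \<bullet> (b' - b))"
    unfolding Phi_def power2_norm_eq_inner by (simp add: algebra_simps inner_commute)
  then have "(norm (p' - p))\<^sup>2 + (norm (q' - q))\<^sup>2 \<le> (p' - p) \<bullet> (a' - a) + (q' - q) \<bullet> (b' - b)"
    using c by simp
  moreover have "2 * ((p' - p) \<bullet> (a' - a)) \<le> (norm (p' - p))\<^sup>2 + (norm (a' - a))\<^sup>2"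
  proof -
    have "0 \<le> (norm ((p' - p) - (a' - a)))\<^sup>2" by simp
    then show ?thesis unfolding power2_norm_eq_inner by (simp add: algebra_simps inner_commute)
  qed
  moreover have "2 * ((q' - q) \<bullet> (b' - b)) \<le> (norm (q' - q))\<^sup>2 + (norm (b' - b))\<^sup>2"
  proof -
    have "0 \<le> (norm ((q' - q) - (b' - b)))\<^sup>2" by simp
    then show ?thesis unfolding power2_norm_eq_inner by (simp add: algebra_simps inner_commute)
  qed
  ultimately show ?thesis by linarith
qed

text \<open>Testing each saddle point against a mixed pair bounds the increment of the saddle value by
  a quadratic expression; the mixed term left over is controlled by nonexpansiveness.\<close>
lemma value_taylor_upper:
  assumes c: "0 < c" and s: "is_saddle c a b p q" and s': "is_saddle c a' b' p' q'"
  shows "Phi c a' b' p' q' - Phi c a b p q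
     \<le> 2 * c * ((a - p) \<bullet> (a' - a) - (b - q) \<bullet> (b' - b)) + 2 * c * ((norm (a' - a))\<^sup>2 + (norm (b' - b))\<^sup>2)"
proof -
  have 1: "Phi c a' b' p' q' \<le> Phi c a' b' p q'" "Phi c a b p q' \<le> Phi c a b p q"
    using s s' by (auto simp: is_saddle_def)
  have 2: "Phi c a' b' p q' - Phi c a b p q' = 2 * c * ((a - p) \<bullet> (a' - a) - (b - q) \<bullet> (b' - b))
      + c * ((norm (a' - a))\<^sup>2 - (norm (b' - b))\<^sup>2 + 2 * ((q' - q) \<bullet> (b' - b)))"
    unfolding Phi_def power2_norm_eq_inner by (simp add: algebra_simps inner_commute)
  have "0 \<le> (norm ((q' - q) - (b' - b)))\<^sup>2" by simp
  then have "2 * ((q' - q) \<bullet> (b' - b)) \<le> (norm (q' - q))\<^sup>2 + (norm (b' - b))\<^sup>2"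
    unfolding power2_norm_eq_inner by (simp add: algebra_simps inner_commute)
  then have "(norm (a' - a))\<^sup>2 - (norm (b' - b))\<^sup>2 + 2 * ((q' - q) \<bullet> (b' - b))
      \<le> 2 * ((norm (a' - a))\<^sup>2 + (norm (b' - b))\<^sup>2)"
    using saddle_nonexpansive[OF assms] zero_le_power2[of "norm (p' - p)"]
      zero_le_power2[of "norm (b' - b)"] by (smt (verit))
  then have "c * ((norm (a' - a))\<^sup>2 - (norm (b' - b))\<^sup>2 + 2 * ((q' - q) \<bullet> (b' - b)))
      \<le> c * (2 * ((norm (a' - a))\<^sup>2 + (norm (b' - b))\<^sup>2))"
    using c by (intro mult_left_mono) auto
  then show ?thesis using 1 2 by linarith
qed

text \<open>The saddle value is differentiable in the centre, with gradient \<open>(2c (a - p), - 2c (b - q))\<close>.\<close>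
lemma value_taylor:
  assumes c: "0 < c" and s: "is_saddle c a b p q" and s': "is_saddle c a' b' p' q'"
  shows "\<bar>Phi c a' b' p' q' - Phi c a b p q - 2 * c * ((a - p) \<bullet> (a' - a) - (b - q) \<bullet> (b' - b))\<bar>
     \<le> 2 * c * ((norm (a' - a))\<^sup>2 + (norm (b' - b))\<^sup>2)"
  using value_taylor_upper[OF assms]
    saddle_function.value_taylor_upper[OF swap c, of b a q p b' a' q' p'] s s'
  by (simp add: saddle_swap Phi_swap algebra_simps abs_le_iff)

lemma value_convex:
  assumes c: "0 < c" and t: "0 \<le> t" "t \<le> 1"
    and s: "is_saddle c a b p q" and s': "is_saddle c a' b p' q'"
    and st: "is_saddle c ((1 - t) *\<^sub>R a + t *\<^sub>R a') b pt qt"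
  shows "Phi c ((1 - t) *\<^sub>R a + t *\<^sub>R a') b pt qt \<le> (1 - t) * Phi c a b p q + t * Phi c a' b p' q'"
proof -
  let ?a = "(1 - t) *\<^sub>R a + t *\<^sub>R a'"
  have "Phi c ?a b pt qt \<le> Phi c ?a b ((1 - t) *\<^sub>R p + t *\<^sub>R p') qt"
    using st by (simp add: is_saddle_def)
  also have "\<dots> \<le> (1 - t) * Phi c a b p qt + t * Phi c a' b p' qt"
    using Phi_convex c t by simp
  also have "\<dots> \<le> (1 - t) * Phi c a b p q + t * Phi c a' b p' q'"
    using s s' t by (intro add_mono mult_left_mono) (auto simp: is_saddle_def)
  finally show ?thesis .
qed

lemma value_le:
  assumes "is_saddle c a b p q"
  shows "Phi c a b p q \<le> F a q - c * (norm (q - b))\<^sup>2"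
  using assms by (auto simp: is_saddle_def Phi_def dest!: spec[of _ a])

lemma majorant:
  assumes c: "2 * C \<le> c"
  shows "F a q - c * (norm (q - b))\<^sup>2 \<le>
    2 * C * (1 + (norm a)\<^sup>2 + (norm b)\<^sup>2) - (c - 2 * C) * (norm (q - b))\<^sup>2"
proof -
  have "C * (norm q)\<^sup>2 \<le> C * (2 * (norm (q - b))\<^sup>2 + 2 * (norm b)\<^sup>2)"
    by (rule mult_left_mono[OF norm_sq_le_double C_nonneg])
  moreover have "0 \<le> C * (1 + (norm a)\<^sup>2)" using C_nonneg by simp
  ultimately show ?thesis using growth[of a q] by (simp add: algebra_simps)
qed

lemma value_upper_growth:
  assumes c: "2 * C \<le> c" and s: "is_saddle c a b p q"
  shows "Phi c a b p q \<le> 2 * C * (1 + (norm a)\<^sup>2 + (norm b)\<^sup>2)"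
proof -
  have "0 \<le> (c - 2 * C) * (norm (q - b))\<^sup>2" using c by simp
  then show ?thesis using value_le[OF s] majorant[OF c, of a q b] by linarith
qed

lemma value_growth:
  assumes c: "2 * C \<le> c" and s: "is_saddle c a b p q"
  shows "\<bar>Phi c a b p q\<bar> \<le> 2 * C * (1 + (norm a)\<^sup>2 + (norm b)\<^sup>2)"
  using value_upper_growth[OF assms]
    saddle_function.value_upper_growth[OF swap c, of b a q p] s
  by (simp add: saddle_swap Phi_swap algebra_simps abs_le_iff)

text \<open>By the growth bound, far maximisers \<open>q\<close> are excluded once \<open>c\<close> is large, and near ones give a value
  close to \<open>F a b\<close> by continuity.\<close>
lemma value_upper_limit:
  assumes e: "0 < e"
  shows "\<exists>c0. \<forall>c\<ge>c0. \<forall>p q. is_saddle c a b p q \<longrightarrow> Phi c a b p q \<le> F a b + e"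
proof -
  obtain d where d: "0 < d" "\<And>y. norm (y - b) < d \<Longrightarrow> \<bar>F a y - F a b\<bar> < e"
    using continuous_right[of a] e unfolding continuous_on_iff dist_norm by (metis UNIV_I real_norm_def)
  define M where "M = \<bar>2 * C * (1 + (norm a)\<^sup>2 + (norm b)\<^sup>2) - F a b\<bar>"
  define c0 where "c0 = 2 * C + M / d\<^sup>2"
  have "Phi c a b p q \<le> F a b + e" if c: "c0 \<le> c" and s: "is_saddle c a b p q" for c p q
  proof (cases "norm (q - b) < d")
    case True
    have "M / d\<^sup>2 \<ge> 0" by (simp add: M_def)
    then have "0 \<le> c * (norm (q - b))\<^sup>2" using c C_nonneg by (simp add: c0_def)
    then show ?thesis using value_le[OF s] d(2)[OF True] by linarith
  next
    case False
    have M0: "M / d\<^sup>2 \<ge> 0" by (simp add: M_def)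
    have "M = (M / d\<^sup>2) * d\<^sup>2" using d by simp
    also have "\<dots> \<le> (c - 2 * C) * (norm (q - b))\<^sup>2"
      using c False d M0 by (intro mult_mono power_mono) (auto simp: c0_def)
    finally have "M \<le> (c - 2 * C) * (norm (q - b))\<^sup>2" .
    moreover have "2 * C \<le> c" using c M0 by (simp add: c0_def)
    ultimately show ?thesis using value_le[OF s] majorant[of c a q b] e unfolding M_def by linarith
  qed
  then show ?thesis by blast
qed

lemma value_limit:
  assumes e: "0 < e"
  shows "\<exists>c0. \<forall>c\<ge>c0. \<forall>p q. is_saddle c a b p q \<longrightarrow> \<bar>Phi c a b p q - F a b\<bar> \<le> e"
proof -
  obtain c1 where c1: "\<And>c p q. c1 \<le> c \<Longrightarrow> is_saddle c a b p q \<Longrightarrow> Phi c a b p q \<le> F a b + e"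
    using value_upper_limit[OF e] by blast
  obtain c2 where c2: "\<And>c p q. c2 \<le> c \<Longrightarrow> is_saddle c a b p q \<Longrightarrow> - Phi c a b p q \<le> - F a b + e"
    using saddle_function.value_upper_limit[OF swap e, of b a]
    by (simp add: saddle_swap Phi_swap) blast
  have "\<bar>Phi c a b p q - F a b\<bar> \<le> e" if "max c1 c2 \<le> c" "is_saddle c a b p q" for c p q
    using c1[of c p q] c2[of c p q] that by (simp add: abs_le_iff)
  then show ?thesis by blast
qed

end

section \<open>Approximation by C11 functions\<close>

context splitting
begin

text \<open>Precomposition with the projections turns a function that is convex-concave on the splitting into one
  that is convex-concave on a product of two full spaces.\<close>
lemma saddle_function_proj:
  assumes cc: "convex_concave V1 V2 f" and C: "0 \<le> C" "\<And>v. \<bar>f v\<bar> \<le> C * (1 + (norm v)\<^sup>2)"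
  shows "saddle_function (\<lambda>p q. f (P p + Q q)) C"
proof
  have 1: "convex_on V1 (\<lambda>a. f (a + Q q))" and 2: "convex_on V2 (\<lambda>b. - f (P p + b))" for p q
    using cc decomp by (auto simp: convex_concave_def concave_on_def)
  show "convex_on UNIV (\<lambda>p. f (P p + Q q))" for q
  proof (rule convex_onI)
    fix t and x y :: "real ^ 'n" assume t: "0 < t" "t < (1::real)"
    show "f (P ((1 - t) *\<^sub>R x + t *\<^sub>R y) + Q q) \<le> (1 - t) * f (P x + Q q) + t * f (P y + Q q)"
      using convex_onD[OF 1[of q], of t "P x" "P y"] t decomp by (simp add: proj_add proj_scale)
  qed simp
  have "convex_on UNIV (\<lambda>q. - f (P p + Q q))" for p
  proof (rule convex_onI)
    fix t and x y :: "real ^ 'n" assume t: "0 < t" "t < (1::real)"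
    show "- f (P p + Q ((1 - t) *\<^sub>R x + t *\<^sub>R y)) \<le> (1 - t) * - f (P p + Q x) + t * - f (P p + Q y)"
      using convex_onD[OF 2[of p], of t "Q x" "Q y"] t decomp by (simp add: proj_add proj_scale)
  qed simp
  then show "concave_on UNIV (\<lambda>q. f (P p + Q q))" for p by (simp add: concave_on_def)
  fix p q
  have "(norm (P p + Q q))\<^sup>2 = (norm (P p))\<^sup>2 + (norm (Q q))\<^sup>2"
    using norm_split[of "P p + Q q"] by (simp add: proj_sum decomp)
  also have "\<dots> \<le> (norm p)\<^sup>2 + (norm q)\<^sup>2"
    using norm_split[of p] norm_split[of q] by simp
  finally have "C * (1 + (norm (P p + Q q))\<^sup>2) \<le> C * (1 + (norm p)\<^sup>2 + (norm q)\<^sup>2)"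
    using C(1) by (intro mult_left_mono) auto
  then show "\<bar>f (P p + Q q)\<bar> \<le> C * (1 + (norm p)\<^sup>2 + (norm q)\<^sup>2)"
    using C(2)[of "P p + Q q"] by linarith
qed

text \<open>The saddle values with the \<open>k\<close>-th parameter \<open>c k\<close>, taken at the centre \<open>(P x, Q x)\<close>, approximate \<open>f\<close>.\<close>
lemma C11_approximation:
  assumes cc: "convex_concave V1 V2 f" and qg: "quadratic_growth f"
  obtains h K where "\<And>k. h k \<in> C11" "\<And>k. convex_concave V1 V2 (h k)"
    "\<And>k x. \<bar>h k x\<bar> \<le> K * (1 + (norm x)\<^sup>2)" "\<And>x. (\<lambda>k. h k x) \<longlonglongrightarrow> f x"
proof -
  obtain C where C: "0 \<le> C" "\<And>v. \<bar>f v\<bar> \<le> C * (1 + (norm v)\<^sup>2)"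
    using qg by (auto simp: quadratic_growth_def)
  define F where "F p q = f (P p + Q q)" for p q
  interpret saddle_function F C
    unfolding F_def by (rule saddle_function_proj[OF cc C])
  define c where "c k = 2 * C + 1 + real k" for k
  have c: "2 * C < c k" "0 < c k" for k using C(1) by (simp_all add: c_def)
  obtain p q where s: "\<And>k a b. is_saddle (c k) a b (p k a b) (q k a b)"
    using saddle_exists[OF c(1)] by metis
  define h where "h k x = Phi (c k) (P x) (Q x) (p k (P x) (Q x)) (q k (P x) (Q x))" for k x
  have C11: "h k \<in> C11" for k
  proof (rule C11I(1))
    define g where "g x = (2 * c k) *\<^sub>R (P (P x - p k (P x) (Q x)) - Q (Q x - q k (P x) (Q x)))" for x
    show "GDERIV (h k) x :> g x" for x
    proof (rule GDERIV_from_quadratic_error)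
      fix y
      have i: "P u \<bullet> v = u \<bullet> P v" "Q u \<bullet> v = u \<bullet> Q v" for u v
        using inner_proj[of u v] inner_proj[of v u] by (simp_all add: inner_commute)
      have "g x \<bullet> (y - x) = 2 * c k * ((P x - p k (P x) (Q x)) \<bullet> (P y - P x)
          - (Q x - q k (P x) (Q x)) \<bullet> (Q y - Q x))"
        by (simp add: g_def inner_diff_left[of "P _"] i flip: proj_diff)
      then show "\<bar>h k y - h k x - g x \<bullet> (y - x)\<bar> \<le> 2 * c k * (norm (y - x))\<^sup>2"
        unfolding h_def norm_split[of "y - x"] proj_diff
        using value_taylor[OF c(2) s s, of k "P y" "Q y" "P x" "Q x"] by (simp only:)
    qed
    show "(4 * c k)-lipschitz_on UNIV g"
    proof (rule lipschitz_on_norm_sqI)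
      fix x y
      define u where "u = (P x - P y) - (p k (P x) (Q x) - p k (P y) (Q y))"
      define v where "v = (Q x - Q y) - (q k (P x) (Q x) - q k (P y) (Q y))"
      have two: "(norm (s - t))\<^sup>2 \<le> 2 * (norm s)\<^sup>2 + 2 * (norm t)\<^sup>2" for s t :: "real ^ 'n"
        using norm_sq_le_double[of "s - t" s] by (simp add: norm_minus_commute)
      have "g x - g y = (2 * c k) *\<^sub>R (P u - Q v)"
        by (simp add: g_def u_def v_def proj_diff proj_add algebra_simps)
      then have "(norm (g x - g y))\<^sup>2 = (2 * c k)\<^sup>2 * (norm (P u - Q v))\<^sup>2"
        by (simp add: power_mult_distrib)
      also have "(norm (P u - Q v))\<^sup>2 = (norm (P u))\<^sup>2 + (norm (Q v))\<^sup>2"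
        using norm_split[of "P u - Q v"] by (simp add: proj_diff proj_in decomp)
      also have "\<dots> \<le> (norm u)\<^sup>2 + (norm v)\<^sup>2"
        using norm_split[of u] norm_split[of v] by simp
      also have "\<dots> \<le> 2 * (norm (P x - P y))\<^sup>2 + 2 * (norm (p k (P x) (Q x) - p k (P y) (Q y)))\<^sup>2
         + (2 * (norm (Q x - Q y))\<^sup>2 + 2 * (norm (q k (P x) (Q x) - q k (P y) (Q y)))\<^sup>2)"
        unfolding u_def v_def by (intro add_mono two)
      also have "\<dots> \<le> 4 * (norm (x - y))\<^sup>2"
        using saddle_nonexpansive[OF c(2) s s, of k "P x" "Q x" "P y" "Q y"] norm_split[of "x - y"]
        by (simp add: proj_diff)
      finally show "(norm (g x - g y))\<^sup>2 \<le> (4 * c k)\<^sup>2 * (norm (x - y))\<^sup>2"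
        by (simp add: power_mult_distrib mult_left_mono)
    qed (use c(2)[of k] in simp)
  qed
  have "convex_concave V1 V2 (h k)" for k
    unfolding convex_concave_def concave_on_def
  proof (intro conjI ballI)
    fix w assume w: "w \<in> V2"
    show "convex_on V1 (\<lambda>v. h k (v + w))"
    proof (rule convex_onI)
      fix t and x y :: "real ^ 'n" assume t: "0 < t" "t < (1::real)" and xy: "x \<in> V1" "y \<in> V1"
      have "(1 - t) *\<^sub>R x + t *\<^sub>R y \<in> V1" using xy sub by (simp add: subspace_add subspace_scale)
      then show "h k ((1 - t) *\<^sub>R x + t *\<^sub>R y + w) \<le> (1 - t) * h k (x + w) + t * h k (y + w)"
        using value_convex[OF c(2) _ _ s s s, of t] t xy w by (simp add: h_def proj_sum)
    qed (simp add: sub subspace_imp_convex)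
  next
    fix w assume w: "w \<in> V1"
    show "convex_on V2 (\<lambda>v. - h k (w + v))"
    proof (rule convex_onI)
      fix t and x y :: "real ^ 'n" assume t: "0 < t" "t < (1::real)" and xy: "x \<in> V2" "y \<in> V2"
      have "(1 - t) *\<^sub>R x + t *\<^sub>R y \<in> V2" using xy sub by (simp add: subspace_add subspace_scale)
      then show "- h k (w + ((1 - t) *\<^sub>R x + t *\<^sub>R y)) \<le> (1 - t) * - h k (w + x) + t * - h k (w + y)"
        using saddle_function.value_convex[OF swap c(2), of t k x w _ _ y, unfolded saddle_swap Phi_swap, OF _ _ s s s] t xy w
        by (simp add: h_def proj_sum)
    qed (simp add: sub subspace_imp_convex)
  qed
  moreover have "\<bar>h k x\<bar> \<le> 2 * C * (1 + (norm x)\<^sup>2)" for k x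
    using value_growth[OF less_imp_le[OF c(1)] s, of k "P x" "Q x"] norm_split[of x]
    by (simp add: h_def add.assoc)
  moreover have "(\<lambda>k. h k x) \<longlonglongrightarrow> f x" for x
  proof (rule LIMSEQ_I)
    fix r :: real assume r: "0 < r"
    obtain c0 where c0: "\<And>c' p q. c0 \<le> c' \<Longrightarrow> is_saddle c' (P x) (Q x) p q
        \<Longrightarrow> \<bar>Phi c' (P x) (Q x) p q - F (P x) (Q x)\<bar> \<le> r / 2"
      using value_limit[of "r / 2"] r by (metis half_gt_zero)
    obtain N where N: "c0 \<le> real N" using real_arch_simple by blast
    have fx: "F (P x) (Q x) = f x" by (simp add: F_def proj_in decomp)
    have "norm (h k x - f x) < r" if k: "N \<le> k" for k
    proof -
      have "c0 \<le> c k" using k N C(1) by (simp add: c_def)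
      from c0[OF this s] show ?thesis using r fx by (simp add: h_def)
    qed
    then show "\<exists>N. \<forall>k\<ge>N. norm (h k x - f x) < r" by blast
  qed
  ultimately show ?thesis using C11 that by blast
qed

text \<open>By dominated convergence, the integral inequality extends from \<open>C11\<close> to all test functions; their Borel
  measurability also follows from the approximation.\<close>
lemma cc_order_from_C11:
  assumes \<mu>: "\<mu> \<in> P2" and \<nu>: "\<nu> \<in> P2"
    and le: "\<And>f. f \<in> C11 \<Longrightarrow> convex_concave V1 V2 f \<Longrightarrow> (\<integral>x. f x \<partial>\<mu>) \<le> (\<integral>x. f x \<partial>\<nu>)"
  shows "cc_order V1 V2 \<mu> \<nu>"
  unfolding cc_order_def
proof (intro allI impI)
  fix f assume f: "convex_concave V1 V2 f \<and> quadratic_growth f"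
  then obtain h K where h: "\<And>k. h k \<in> C11" "\<And>k. convex_concave V1 V2 (h k)"
    "\<And>k x. \<bar>h k x\<bar> \<le> K * (1 + (norm x)\<^sup>2)" "\<And>x. (\<lambda>k. h k x) \<longlonglongrightarrow> f x"
    using C11_approximation by blast
  have mf: "f \<in> borel_measurable borel"
    by (rule borel_measurable_LIMSEQ_real[OF h(4) C11_borel[OF h(1)]])
  have lim: "(\<lambda>k. \<integral>x. h k x \<partial>\<rho>) \<longlonglongrightarrow> (\<integral>x. f x \<partial>\<rho>)" if \<rho>: "\<rho> \<in> P2" for \<rho>
  proof (rule integral_dominated_convergence[where w = "\<lambda>x. K * (1 + (norm x)\<^sup>2)"])
    have [simp]: "sets \<rho> = sets borel" using \<rho> by (simp add: P2_def)
    show "f \<in> borel_measurable \<rho>" "h k \<in> borel_measurable \<rho>" for k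
      using mf C11_borel[OF h(1)] by (simp_all cong: measurable_cong_sets)
    show "integrable \<rho> (\<lambda>x. K * (1 + (norm x)\<^sup>2))" by (rule P2_integrable_quadratic_bound[OF \<rho>])
  qed (simp_all add: h)
  show "(\<integral>x. f x \<partial>\<mu>) \<le> (\<integral>x. f x \<partial>\<nu>)"
    by (rule LIMSEQ_le[OF lim[OF \<mu>] lim[OF \<nu>]]) (use le h in blast)
qed

section \<open>Variations of the quadratic function\<close>

text \<open>Subtracting \<open>e f\<close> from the quadratic function increases the Lipschitz constant of the gradient only
  to second order in \<open>e\<close>: in the squared norm of \<open>J (x - y) - e (grad f x - grad f y)\<close> the first-order term has
  the favourable sign, by monotonicity.\<close>
lemma perturbation_admissible:
  assumes f: "f \<in> C11" and cc: "convex_concave V1 V2 f" and L: "L-lipschitz_on UNIV (gradient f)"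
    and e: "0 \<le> e"
  defines "s \<equiv> sqrt (1 + e\<^sup>2 * L\<^sup>2)"
  shows "(\<lambda>x. (1 / s) * u_quad V1 V2 x + (- e / s) * f x) \<in> admissible"
proof -
  have s: "0 < s" "s\<^sup>2 = 1 + e\<^sup>2 * L\<^sup>2"
    by (simp_all add: s_def add_pos_nonneg)
  let ?g = "\<lambda>x. (1 / s) *\<^sub>R J x + (- e / s) *\<^sub>R gradient f x"
  have "1-lipschitz_on UNIV ?g"
  proof (rule lipschitz_on_norm_sqI)
    fix x y
    let ?d = "gradient f x - gradient f y"
    have "?g x - ?g y = (1 / s) *\<^sub>R (J (x - y) - e *\<^sub>R ?d)"
      by (simp add: J_diff algebra_simps)
    then have "(norm (?g x - ?g y))\<^sup>2 = (norm (J (x - y) - e *\<^sub>R ?d))\<^sup>2 / s\<^sup>2"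
      by (simp add: power_divide)
    also have "(norm (J (x - y) - e *\<^sub>R ?d))\<^sup>2
        = (norm (x - y))\<^sup>2 - 2 * (e * (J (x - y) \<bullet> ?d)) + e\<^sup>2 * (norm ?d)\<^sup>2"
    proof -
      have "(norm (a - e *\<^sub>R b))\<^sup>2 = (norm a)\<^sup>2 - 2 * (e * (a \<bullet> b)) + e\<^sup>2 * (norm b)\<^sup>2" for a b :: "real ^ 'n"
        unfolding power2_norm_eq_inner
        by (simp add: algebra_simps inner_commute power2_eq_square)
      from this[of "J (x - y)" ?d] show ?thesis by (simp only: norm_J)
    qed
    also have "\<dots> \<le> (norm (x - y))\<^sup>2 + e\<^sup>2 * (L\<^sup>2 * (norm (x - y))\<^sup>2)"
    proof -
      have "0 \<le> e * (J (x - y) \<bullet> ?d)"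
        using e saddle_gradient_monotone[OF cc C11D(1)[OF f], of x y] by simp
      moreover have "(norm ?d)\<^sup>2 \<le> (L * norm (x - y))\<^sup>2"
        by (intro power_mono lipschitz_on_normD(1)[OF L]) simp
      then have "e\<^sup>2 * (norm ?d)\<^sup>2 \<le> e\<^sup>2 * (L\<^sup>2 * (norm (x - y))\<^sup>2)"
        by (intro mult_left_mono) (simp_all add: power_mult_distrib)
      ultimately show ?thesis by linarith
    qed
    also have "\<dots> = s\<^sup>2 * (norm (x - y))\<^sup>2" by (simp add: s algebra_simps)
    finally show "(norm (?g x - ?g y))\<^sup>2 \<le> 1\<^sup>2 * (norm (x - y))\<^sup>2"
      using s(1) by (simp add: divide_right_mono)
  qed simp
  then show ?thesis
    using C11_lincomb[OF u_quad_C11 f, of "1 / s" "- e / s"]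
    by (simp add: admissible_def gradient_u_quad)
qed

text \<open>First variation: optimality of the quadratic function against the perturbations above gives
  \<open>- D \<le> e L\<^sup>2 \<bar>U\<bar>\<close> for every \<open>e > 0\<close>, where \<open>D\<close> and \<open>U\<close> are the integrals of \<open>f\<close> and of the quadratic function
  against \<open>\<nu> - \<mu>\<close>.\<close>
lemma C11_order_from_attains:
  assumes \<mu>: "\<mu> \<in> P2" and \<nu>: "\<nu> \<in> P2" and att: "attains_I \<mu> \<nu> (u_quad V1 V2)"
    and f: "f \<in> C11" and cc: "convex_concave V1 V2 f"
  shows "(\<integral>x. f x \<partial>\<mu>) \<le> (\<integral>x. f x \<partial>\<nu>)"
proof -
  obtain L where L: "L-lipschitz_on UNIV (gradient f)" using C11D(2)[OF f] by blast
  define D where "D = integral_diff \<mu> \<nu> f"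
  define U where "U = integral_diff \<mu> \<nu> (u_quad V1 V2)"
  have key: "- D \<le> e * (L\<^sup>2 * \<bar>U\<bar>)" if e: "0 < e" for e
  proof -
    define s where "s = sqrt (1 + e\<^sup>2 * L\<^sup>2)"
    have "1 \<le> s" by (simp add: s_def)
    moreover have "s\<^sup>2 = 1 + e\<^sup>2 * L\<^sup>2" by (simp add: s_def)
    moreover have "s * 1 \<le> s * s" using \<open>1 \<le> s\<close> by (intro mult_left_mono) auto
    ultimately have s: "1 \<le> s" "s - 1 \<le> e\<^sup>2 * L\<^sup>2" by (simp_all add: power2_eq_square)
    have "integral_diff \<mu> \<nu> (\<lambda>x. (1 / s) * u_quad V1 V2 x + (- e / s) * f x) \<le> U"
      using att perturbation_admissible[OF f cc L, of e] e
      by (simp add: attains_I_iff U_def s_def)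
    then have "(1 / s) * U + (- e / s) * D \<le> U"
      by (simp only: integral_diff_lincomb[OF \<mu> \<nu> u_quad_C11 f] U_def D_def)
    then have "U - e * D \<le> s * U" using s(1) by (simp add: field_simps)
    then have "e * - D \<le> (s - 1) * U" by (simp add: algebra_simps)
    also have "\<dots> \<le> (s - 1) * \<bar>U\<bar>" using s by (intro mult_left_mono) auto
    also have "\<dots> \<le> (e\<^sup>2 * L\<^sup>2) * \<bar>U\<bar>" using s by (intro mult_right_mono) auto
    also have "\<dots> = e * (e * (L\<^sup>2 * \<bar>U\<bar>))" by (simp add: power2_eq_square)
    finally show ?thesis using e by (simp only: mult_le_cancel_left_pos)
  qed
  have "0 \<le> D"
  proof (rule ccontr)
    assume "\<not> 0 \<le> D"
    then have D: "0 < - D" by simp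
    \<comment> \<open>the added 1 keeps \<open>M\<close> positive; with \<open>e = - D / (2 M)\<close> the bound \<open>key\<close> gives \<open>- D \<le> - D / 2\<close>\<close>
    define M where "M = L\<^sup>2 * \<bar>U\<bar> + 1"
    have M: "0 < M" by (simp add: M_def add_nonneg_pos)
    have pos: "0 < - D / (2 * M)" using D M by (intro divide_pos_pos) auto
    have "- D \<le> (- D / (2 * M)) * (L\<^sup>2 * \<bar>U\<bar>)" by (rule key[OF pos])
    also have "\<dots> \<le> (- D / (2 * M)) * M"
      by (rule mult_left_mono[OF _ less_imp_le[OF pos]]) (simp add: M_def)
    also have "\<dots> = - D / 2" using M by simp
    finally show False using D by simp
  qed
  then show ?thesis by (simp add: D_def integral_diff_def)
qed

lemma attains_from_C11_order:
  assumes \<mu>: "\<mu> \<in> P2" and \<nu>: "\<nu> \<in> P2"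
    and le: "\<And>f. f \<in> C11 \<Longrightarrow> convex_concave V1 V2 f \<Longrightarrow> (\<integral>x. f x \<partial>\<mu>) \<le> (\<integral>x. f x \<partial>\<nu>)"
  shows "attains_I \<mu> \<nu> (u_quad V1 V2)"
  unfolding attains_I_iff
proof (intro conjI ballI u_quad_admissible)
  fix v :: "real ^ 'n \<Rightarrow> real" assume v: "v \<in> admissible"
  then have vC: "v \<in> C11" by (simp add: admissible_def)
  have "(\<lambda>x. u_quad V1 V2 x - v x) \<in> C11"
    using C11_lincomb(1)[OF u_quad_C11 vC, of 1 "-1"] by simp
  from le[OF this u_quad_minus_admissible_cc[OF v]]
  have "0 \<le> integral_diff \<mu> \<nu> (\<lambda>x. 1 * u_quad V1 V2 x + (-1) * v x)"
    by (simp add: integral_diff_def)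
  then show "integral_diff \<mu> \<nu> v \<le> integral_diff \<mu> \<nu> (u_quad V1 V2)"
    by (simp only: integral_diff_lincomb[OF \<mu> \<nu> u_quad_C11 vC])
qed

end

section \<open>Functions with isometric gradient\<close>

lemma orthogonal_involution_splitting:
  fixes A :: "real ^ 'n \<Rightarrow> real ^ 'n"
  assumes lin: "linear A" and inv: "\<And>x. A (A x) = x" and sym: "\<And>x y. A x \<bullet> y = x \<bullet> A y"
  shows "splitting {x. A x = x} {x. A x = - x}"
    and "u_quad {x. A x = x} {x. A x = - x} x = 1 / 2 * (A x \<bullet> x)"
proof -
  let ?V = "{x. A x = x}" and ?W = "{x. A x = - x}"
  note l = linear_add[OF lin] linear_diff[OF lin] linear_scale[OF lin] linear_0[OF lin]
  define p where "p x = (1 / 2) *\<^sub>R (x + A x)" for x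
  define q where "q x = (1 / 2) *\<^sub>R (x - A x)" for x
  have pq: "p x \<in> ?V" "q x \<in> ?W" "p x + q x = x" for x
  proof -
    show "p x \<in> ?V" "q x \<in> ?W" by (simp_all add: p_def q_def l inv algebra_simps)
    have "p x + q x = (1 / 2) *\<^sub>R x + (1 / 2) *\<^sub>R x" by (simp add: p_def q_def algebra_simps)
    then show "p x + q x = x" by (simp flip: scaleR_add_left)
  qed
  have orth: "v \<bullet> w = 0" if "A v = v" "A w = - w" for v w
  proof -
    have "v \<bullet> w = - (v \<bullet> w)" using sym[of v w] that by simp
    then show ?thesis by simp
  qed
  show spl: "splitting ?V ?W"
  proof
    have "subspace ?V" "subspace ?W" by (auto simp: subspace_def l)
    moreover have "?V \<inter> ?W = {0}"
    proof -
      have "v = 0" if "A v = v" "A v = - v" for v using orth[OF that] by simp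
      then show ?thesis using l(4) by auto
    qed
    moreover have "{v1 + v2 |v1 v2. v1 \<in> ?V \<and> v2 \<in> ?W} = UNIV"
    proof -
      have "\<exists>v1 v2. x = v1 + v2 \<and> v1 \<in> ?V \<and> v2 \<in> ?W" for x
        using pq[of x] by (intro exI[of _ "p x"] exI[of _ "q x"]) (simp only: simp_thms)
      then show ?thesis by blast
    qed
    ultimately show "mutually_complementing ?V ?W" by (simp add: mutually_complementing_def)
    show "orthogonal_sets ?V ?W" using orth by (simp add: orthogonal_sets_def orthogonal_def)
  qed
  interpret splitting ?V ?W by (rule spl)
  have "P x = p x" "Q x = q x" using proj_sum[OF pq(1,2), of x x] pq(3) by simp_all
  then have "J x = A x" by (simp add: J_def p_def q_def flip: scaleR_diff_right scaleR_2)
  then show "u_quad ?V ?W x = 1 / 2 * (A x \<bullet> x)" by (simp add: u_quad_eq)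
qed

text \<open>An isometry is affine, so integration along rays makes \<open>u\<close> a quadratic polynomial. The gradient of
  that polynomial only sees the symmetric part of the linear part \<open>A\<close>; hence \<open>A\<close> is symmetric, and being
  orthogonal as well it is an involution.\<close>
lemma isometric_gradient_quadratic:
  fixes u :: "real ^ 'n \<Rightarrow> real"
  assumes u: "\<And>x. GDERIV u x :> g x" and iso: "isometry g"
  obtains A where "linear A" "\<And>x. A (A x) = x" "\<And>x y. A x \<bullet> y = x \<bullet> A y"
    "\<And>x. u x = u 0 + g 0 \<bullet> x + 1 / 2 * (A x \<bullet> x)"
proof -
  define A where "A x = g x - g 0" for x
  have ot: "orthogonal_transformation A"
    unfolding orthogonal_transformation_isometry using iso by (simp add: A_def isometry_def dist_norm)
  then have lin: "linear A" and pres: "\<And>x y. A x \<bullet> A y = x \<bullet> y"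
    by (auto simp: orthogonal_transformation_def)
  note l = linear_add[OF lin] linear_diff[OF lin] linear_scale[OF lin] linear_0[OF lin]
  have formula: "u x = u 0 + g 0 \<bullet> x + 1 / 2 * (A x \<bullet> x)" for x
  proof -
    define k where "k t = u (0 + t *\<^sub>R x) - t * (g 0 \<bullet> x) - t\<^sup>2 / 2 * (A x \<bullet> x)" for t
    have "(k has_real_derivative 0) (at t)" for t
    proof -
      have "(k has_real_derivative x \<bullet> g (0 + t *\<^sub>R x) - (g 0 \<bullet> x) - t * (A x \<bullet> x)) (at t)"
        unfolding k_def by (auto intro!: derivative_eq_intros GDERIV_along_line[OF u, of 0 x, simplified])
      moreover have "g (0 + t *\<^sub>R x) = t *\<^sub>R A x + g 0" using l(3)[of t x] by (simp add: A_def algebra_simps)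
      ultimately show ?thesis by (simp add: inner_add_right inner_commute)
    qed
    then have "k 1 = k 0" by (intro DERIV_isconst_all) blast
    then show ?thesis by (simp add: k_def)
  qed
  have sym: "A x \<bullet> y = x \<bullet> A y" for x y
  proof -
    define B where "B = (1 / 2) *\<^sub>R (A x + adjoint A x)"
    have adj: "A z \<bullet> w = z \<bullet> adjoint A w" for z w by (simp add: adjoint_works[OF lin])
    have "GDERIV u x :> g 0 + B"
    proof (rule GDERIV_from_quadratic_error)
      fix z
      have "u z - u x - (g 0 + B) \<bullet> (z - x) = 1 / 2 * (A (z - x) \<bullet> (z - x))"
        unfolding formula[of z] formula[of x] B_def
        by (simp add: l algebra_simps inner_commute adjoint_works[OF lin])
      also have "\<bar>\<dots>\<bar> \<le> 1 / 2 * (norm (A (z - x)) * norm (z - x))"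
        using Cauchy_Schwarz_ineq2[of "A (z - x)" "z - x"] by (simp add: abs_mult)
      also have "norm (A (z - x)) = norm (z - x)" using ot by (simp add: orthogonal_transformation)
      finally show "\<bar>u z - u x - (g 0 + B) \<bullet> (z - x)\<bar> \<le> 1 / 2 * (norm (z - x))\<^sup>2"
        by (simp add: power2_eq_square)
    qed
    then have "A x = B" using GDERIV_unique[OF u[of x]] by (simp add: A_def)
    moreover have "2 *\<^sub>R B = A x + adjoint A x" by (simp add: B_def)
    ultimately have "2 *\<^sub>R A x = A x + adjoint A x" by simp
    then have "A x = adjoint A x" by (simp add: scaleR_2)
    then show ?thesis using adj[of y x] by (simp add: inner_commute)
  qed
  have "A (A x) = x" for x
  proof -
    have "(A (A x) - x) \<bullet> y = 0" for y
      using sym[of "A x" y] pres[of x y] by (simp add: inner_diff_left)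
    then have "(A (A x) - x) \<bullet> (A (A x) - x) = 0" .
    then show ?thesis by simp
  qed
  then show ?thesis using that[of A] lin sym formula by blast
qed

lemma integral_diff_affine:
  assumes \<mu>: "\<mu> \<in> P2" and \<nu>: "\<nu> \<in> P2" and bary: "barycentre \<mu> = barycentre \<nu>"
    and w: "w \<in> C11" and u: "\<And>x. u x = c + b \<bullet> x + w x"
  shows "integral_diff \<mu> \<nu> u = integral_diff \<mu> \<nu> w"
proof -
  have "(\<integral>x. u x \<partial>\<rho>) = c + b \<bullet> barycentre \<rho> + (\<integral>x. w x \<partial>\<rho>)" if \<rho>: "\<rho> \<in> P2" for \<rho>
  proof -
    interpret prob_space \<rho> using \<rho> by (simp add: P2_def)
    have [simp]: "sets \<rho> = sets borel" using \<rho> by (simp add: P2_def)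
    have i: "integrable \<rho> (\<lambda>x. x)"
    proof (rule Bochner_Integration.integrable_bound[OF P2_integrable_quadratic_bound[OF \<rho>, of 1]])
      show "(\<lambda>x. x) \<in> borel_measurable \<rho>" by (simp cong: measurable_cong_sets)
      have "norm x \<le> 1 + (norm x)\<^sup>2" for x :: "real ^ 'a"
        using sum_squares_bound[of 1 "norm x"] norm_ge_zero[of x] unfolding one_power2 by linarith
      then show "AE x in \<rho>. norm x \<le> norm (1 * (1 + (norm x)\<^sup>2))"
        by (intro AE_I2) (metis abs_ge_self mult_1 order_trans real_norm_def)
    qed
    then show ?thesis unfolding u barycentre_def
      using C11_integrable[OF \<rho> w] by (simp add: prob_space)
  qed
  then show ?thesis using \<mu> \<nu> bary by (simp add: integral_diff_def)
qed

section \<open>The equivalence\<close>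

theorem proposition3p7:
  fixes \<mu> \<nu> :: "(real ^ 'n) measure"
  assumes "\<mu> \<in> P2" and "\<nu> \<in> P2"
    and "barycentre \<mu> = barycentre \<nu>"
  defines "cond_i \<equiv>
      (\<exists>V1 V2. mutually_complementing V1 V2 \<and> orthogonal_sets V1 V2 \<and> cc_order V1 V2 \<mu> \<nu>)"
    and "cond_ii \<equiv>
      (\<exists>V1 V2. mutually_complementing V1 V2 \<and> orthogonal_sets V1 V2 \<and>
         (\<forall>f\<in>C11. convex_concave V1 V2 f \<longrightarrow> (\<integral>x. f x \<partial>\<mu>) \<le> (\<integral>x. f x \<partial>\<nu>)))"
    and "cond_iii \<equiv>
      (\<exists>u\<in>C11. attains_I \<mu> \<nu> u \<and> isometry (gradient u))"
    and "cond_iv \<equiv>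
      (\<exists>V1 V2. mutually_complementing V1 V2 \<and> orthogonal_sets V1 V2 \<and>
         attains_I \<mu> \<nu> (u_quad V1 V2))"
  shows "(cond_i \<longleftrightarrow> cond_ii) \<and> (cond_ii \<longleftrightarrow> cond_iii) \<and> (cond_iii \<longleftrightarrow> cond_iv)"
proof -
  have split_iff: "mutually_complementing V1 V2 \<and> orthogonal_sets V1 V2 \<and> R \<longleftrightarrow> splitting V1 V2 \<and> R"
    for V1 V2 :: "(real ^ 'n) set" and R
    by (auto simp: splitting_def)
  have i_ii: "cond_i \<longleftrightarrow> cond_ii"
    unfolding cond_i_def cond_ii_def split_iff
    using splitting.cc_order_from_C11[OF _ assms(1,2)] C11_quadratic_growth
    unfolding cc_order_def by metis
  have ii_iv: "cond_ii \<longleftrightarrow> cond_iv"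
    unfolding cond_ii_def cond_iv_def split_iff
    using splitting.attains_from_C11_order[OF _ assms(1,2)]
      splitting.C11_order_from_attains[OF _ assms(1,2)] by metis
  have "cond_iv" if iii: "cond_iii"
  proof -
    obtain u where u: "u \<in> C11" "attains_I \<mu> \<nu> u" "isometry (gradient u)"
      using iii by (auto simp: cond_iii_def)
    obtain A where A: "linear A" "\<And>x. A (A x) = x" "\<And>x y. A x \<bullet> y = x \<bullet> A y"
      "\<And>x. u x = u 0 + gradient u 0 \<bullet> x + 1 / 2 * (A x \<bullet> x)"
      using isometric_gradient_quadratic[OF C11D(1)[OF u(1)] u(3)] by blast
    let ?V = "{x. A x = x}" and ?W = "{x. A x = - x}"
    have spl: "splitting ?V ?W" by (rule orthogonal_involution_splitting(1)[OF A(1-3)])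
    have "integral_diff \<mu> \<nu> u = integral_diff \<mu> \<nu> (u_quad ?V ?W)"
    proof (rule integral_diff_affine[OF assms(1-3) splitting.u_quad_C11[OF spl]])
      show "u x = u 0 + gradient u 0 \<bullet> x + u_quad ?V ?W x" for x
        unfolding orthogonal_involution_splitting(2)[OF A(1-3)] by (rule A(4))
    qed
    then have "attains_I \<mu> \<nu> (u_quad ?V ?W)"
      using u(2) splitting.u_quad_admissible[OF spl] by (simp add: attains_I_iff)
    then show ?thesis unfolding cond_iv_def split_iff using spl by blast
  qed
  moreover have "cond_iii" if "cond_iv"
    using that unfolding cond_iii_def cond_iv_def split_iff
    using splitting.u_quad_C11 splitting.isometry_J splitting.gradient_u_quad by metis
  ultimately show ?thesis using i_ii ii_iv by blast
qed

end
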